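(* Let $\varphi(z)=\dfrac{az+b}{cz+d}$ be a nonconstant linear-fractional selfmap of the open unit disk $\mathbb{D}$, and let $\sigma(z)=\dfrac{\overline{a}z-\overline{c}}{-\overline{b}z+\overline{d}}$ be its adjoint selfmap of $\mathbb{D}$. The following are equivalent: (a) $C_\varphi:H^2\to H^2$ is coposinormal; (b) $\bigl\{1/\overline{u}:u\in\varphi(\mathbb{D})\bigr\}\cap\varphi^{-1}(\mathbb{D})=\emptyset$; (c) $\sigma\circ\varphi^{-1}$ is a selfmap of $\mathbb{D}$.
   Context: $H^2$ is the Hilbert space of analytic functions $f(z)=\sum_{n\ge 0}a_nz^n$ on $\mathbb{D}$ with $\|f\|^2=\sum|a_n|^2<\infty$, and $C_\varphi f=f\circ\varphi$ (bounded on $H^2$). The adjoint $\sigma$ of a linear-fractional selfmap $\varphi$ of $\mathbb{D}$ is the map given in the claim; it is known to be an analytic selfmap of $\mathbb{D}$. All nonconstant linear-fractional maps are regarded as bijections of the extended complex plane $\mathbb{C}_\infty$, so $\varphi^{-1}$ is the inverse on $\mathbb{C}_\infty$; the convention $1/0=\infty$ is used; "$\sigma\circ\varphi^{-1}$ is a selfmap of $\mathbb{D}$" means $(\sigma\circ\varphi^{-1})(\mathbb{D})\subseteq\mathbb{D}$. A bounded linear operator $A$ on a Hilbert space is posinormal if there is a positive operator $P$ with $AA^*=A^*PA$ (equivalently, $\operatorname{ran}A\subseteq\operatorname{ran}A^*$); $A$ is coposinormal if $A^*$ is posinormal. *)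

theory Defs
  imports "HOL-Complex_Analysis.Complex_Analysis"
begin

section \<open>Complex Hilbert spaces and posinormal operators\<close>

text \<open>
  The library only has real inner product spaces. The complex structure is added on top of the
  real one, so that \<open>norm\<close>, limits and \<open>bounded_linear\<close> keep their library meaning. The complex
  inner product is linear in its first argument.
\<close>

class complex_hilbert_space = real_inner + complete_space +
  fixes scaleC :: "complex \<Rightarrow> 'a \<Rightarrow> 'a"  (infixr "*\<^sub>C" 75)
    and cinner :: "'a \<Rightarrow> 'a \<Rightarrow> complex"
  assumes scaleC_add_right: "c *\<^sub>C (x + y) = c *\<^sub>C x + c *\<^sub>C y"
    and scaleC_add_left: "(b + c) *\<^sub>C x = b *\<^sub>C x + c *\<^sub>C x"
    and scaleC_scaleC: "b *\<^sub>C (c *\<^sub>C x) = (b * c) *\<^sub>C x"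
    and scaleC_of_real: "complex_of_real r *\<^sub>C x = r *\<^sub>R x"
    and cinner_commute: "cinner x y = cnj (cinner y x)"
    and cinner_add_left: "cinner (x + y) z = cinner x z + cinner y z"
    and cinner_scaleC_left: "cinner (c *\<^sub>C x) y = c * cinner x y"
    and inner_eq_Re_cinner: "inner x y = Re (cinner x y)"

definition bounded_clinear ::
  "('a::complex_hilbert_space \<Rightarrow> 'b::complex_hilbert_space) \<Rightarrow> bool" where
  "bounded_clinear A \<longleftrightarrow> bounded_linear A \<and> (\<forall>c x. A (c *\<^sub>C x) = c *\<^sub>C A x)"

text \<open>
  Only used for bounded complex-linear \<open>A\<close>, where the adjoint exists and is unique.
\<close>

definition cadjoint ::
  "('a::complex_hilbert_space \<Rightarrow> 'b::complex_hilbert_space) \<Rightarrow> 'b \<Rightarrow> 'a" where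
  "cadjoint A = (THE B. \<forall>x y. cinner (A x) y = cinner x (B y))"

definition positive_operator :: "('a::complex_hilbert_space \<Rightarrow> 'a) \<Rightarrow> bool" where
  "positive_operator P \<longleftrightarrow> bounded_clinear P \<and> (\<forall>x. cinner (P x) x \<in> \<real>\<^sub>\<ge>\<^sub>0)"

definition posinormal :: "('a::complex_hilbert_space \<Rightarrow> 'a) \<Rightarrow> bool" where
  "posinormal A \<longleftrightarrow> bounded_clinear A \<and>
     (\<exists>P. positive_operator P \<and> A \<circ> cadjoint A = cadjoint A \<circ> P \<circ> A)"

definition coposinormal :: "('a::complex_hilbert_space \<Rightarrow> 'a) \<Rightarrow> bool" where
  "coposinormal A \<longleftrightarrow> bounded_clinear A \<and> posinormal (cadjoint A)"


section \<open>The Hardy space of the unit disk\<close>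

definition taylor_coeff :: "(complex \<Rightarrow> complex) \<Rightarrow> nat \<Rightarrow> complex" where
  "taylor_coeff f n = (deriv ^^ n) f 0 / fact n"

text \<open>
  HOL functions are total, so a function on the disk is represented by the total function that
  vanishes off the disk; this makes equality in \<open>H\<^sup>2\<close> coincide with equality on the disk.
\<close>

definition hardy_set :: "(complex \<Rightarrow> complex) set" where
  "hardy_set = {f. f holomorphic_on ball 0 1 \<and> (\<forall>z. z \<notin> ball 0 1 \<longrightarrow> f z = 0) \<and>
                   summable (\<lambda>n. (cmod (taylor_coeff f n))\<^sup>2)}"

lemma taylor_coeff_0 [simp]: "taylor_coeff (\<lambda>_. 0) n = 0"
proof -
  have "(deriv ^^ n) (\<lambda>_. 0) = (\<lambda>_. 0::complex)"
    by (induction n) auto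
  then show ?thesis by (simp add: taylor_coeff_def)
qed

typedef hardy = hardy_set
  morphisms h2_fun Abs_hardy
proof
  show "(\<lambda>_. 0) \<in> hardy_set" by (simp add: hardy_set_def)
qed

definition h2_coeff :: "hardy \<Rightarrow> nat \<Rightarrow> complex" where
  "h2_coeff f n = taylor_coeff (h2_fun f) n"

lemma h2_fun_holomorphic: "h2_fun f holomorphic_on ball 0 1"
  and h2_fun_outside: "z \<notin> ball 0 1 \<Longrightarrow> h2_fun f z = 0"
  and h2_coeff_summable: "summable (\<lambda>n. (cmod (h2_coeff f n))\<^sup>2)"
  using h2_fun[of f] by (auto simp: hardy_set_def h2_coeff_def)

lemma h2_fun_sums:
  assumes "z \<in> ball 0 1"
  shows "(\<lambda>n. h2_coeff f n * z ^ n) sums h2_fun f z"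
  using holomorphic_power_series[OF h2_fun_holomorphic assms, of f]
  by (simp add: h2_coeff_def taylor_coeff_def)

lemma hardy_eqI:
  assumes "\<And>n. h2_coeff f n = h2_coeff g n"
  shows "f = g"
proof -
  have "h2_fun f z = h2_fun g z" for z
  proof (cases "z \<in> ball 0 1")
    case True
    then show ?thesis
      using h2_fun_sums[of z f] h2_fun_sums[of z g] assms by (auto intro: sums_unique2)
  qed (simp add: h2_fun_outside)
  then show ?thesis by (metis h2_fun_inject ext)
qed

lemma square_summable_prod:
  fixes a b :: "nat \<Rightarrow> complex"
  assumes "summable (\<lambda>n. (cmod (a n))\<^sup>2)" "summable (\<lambda>n. (cmod (b n))\<^sup>2)"
  shows "summable (\<lambda>n. cmod (a n * b n))"
proof (rule summable_comparison_test'[where N = 0])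
  show "summable (\<lambda>n. (cmod (a n))\<^sup>2 + (cmod (b n))\<^sup>2)"
    using assms by (rule summable_add)
  show "norm (cmod (a n * b n)) \<le> (cmod (a n))\<^sup>2 + (cmod (b n))\<^sup>2" for n
  proof -
    have "2 * cmod (a n) * cmod (b n) \<le> (cmod (a n))\<^sup>2 + (cmod (b n))\<^sup>2"
      by (rule sum_squares_bound)
    moreover have "0 \<le> cmod (a n) * cmod (b n)" by simp
    ultimately show ?thesis unfolding norm_mult real_norm_def abs_mult abs_norm_cancel by linarith
  qed
qed

lemma square_summable_add:
  fixes a b :: "nat \<Rightarrow> complex"
  assumes "summable (\<lambda>n. (cmod (a n))\<^sup>2)" "summable (\<lambda>n. (cmod (b n))\<^sup>2)"
  shows "summable (\<lambda>n. (cmod (a n + b n))\<^sup>2)"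
proof (rule summable_comparison_test'[where N = 0])
  show "summable (\<lambda>n. 2 * (cmod (a n))\<^sup>2 + 2 * (cmod (b n))\<^sup>2)"
    using assms by (intro summable_add summable_mult)
  show "norm ((cmod (a n + b n))\<^sup>2) \<le> 2 * (cmod (a n))\<^sup>2 + 2 * (cmod (b n))\<^sup>2" for n
  proof -
    have "(cmod (a n + b n))\<^sup>2 \<le> (cmod (a n) + cmod (b n))\<^sup>2"
      by (intro power_mono norm_triangle_ineq) auto
    also have "\<dots> \<le> 2 * (cmod (a n))\<^sup>2 + 2 * (cmod (b n))\<^sup>2"
      using sum_squares_bound[of "cmod (a n)" "cmod (b n)"] by (simp add: power2_sum)
    finally show ?thesis by simp
  qed
qed

lemma square_summable_cmult:
  fixes a :: "nat \<Rightarrow> complex"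
  assumes "summable (\<lambda>n. (cmod (a n))\<^sup>2)"
  shows "summable (\<lambda>n. (cmod (c * a n))\<^sup>2)"
  using summable_mult[OF assms, of "(cmod c)\<^sup>2"] by (simp add: norm_mult power_mult_distrib)

lemma hardy_of_coeffs:
  fixes a :: "nat \<Rightarrow> complex"
  assumes a: "summable (\<lambda>n. (cmod (a n))\<^sup>2)"
  obtains f where "\<And>n. h2_coeff f n = a n"
proof -
  define g where "g = (\<lambda>z::complex. if z \<in> ball 0 1 then \<Sum>n. a n * z ^ n else 0)"
  have sums: "(\<lambda>n. a n * z ^ n) sums g z" if z: "z \<in> ball 0 1" for z
  proof -
    have "summable (\<lambda>n. ((cmod z)\<^sup>2) ^ n)"
      using z by (intro summable_geometric) (auto simp: power_less_one_iff abs_square_less_1)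
    then have "summable (\<lambda>n. (cmod (z ^ n))\<^sup>2)"
      by (simp add: norm_power power_mult [symmetric] mult.commute)
    from square_summable_prod[OF a this] have "summable (\<lambda>n. a n * z ^ n)"
      by (rule summable_norm_cancel)
    then show ?thesis using z by (simp add: g_def summable_sums)
  qed
  have hol: "g holomorphic_on ball 0 1"
    using power_series_holomorphic[of 0 1 a g] sums by simp
  have "g has_fps_expansion Abs_fps a"
  proof (rule has_fps_expansionI)
    have "eventually (\<lambda>z::complex. z \<in> ball 0 1) (nhds 0)"
      by (intro eventually_nhds_in_open) auto
    then show "eventually (\<lambda>u. (\<lambda>n. fps_nth (Abs_fps a) n * u ^ n) sums g u) (nhds 0)"
      by eventually_elim (use sums in auto)
  qed
  from fps_nth_fps_expansion[OF this] have coeff: "taylor_coeff g n = a n" for n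
    by (simp add: taylor_coeff_def)
  have "g \<in> hardy_set"
    unfolding hardy_set_def mem_Collect_eq coeff using hol a by (auto simp: g_def)
  then have "h2_coeff (Abs_hardy g) n = a n" for n
    by (simp add: h2_coeff_def Abs_hardy_inverse coeff)
  then show ?thesis by (rule that)
qed

lemma hardy_set_add:
  assumes "f \<in> hardy_set" "g \<in> hardy_set"
  shows "(\<lambda>z. f z + g z) \<in> hardy_set"
    and "taylor_coeff (\<lambda>z. f z + g z) n = taylor_coeff f n + taylor_coeff g n"
proof -
  have *: "taylor_coeff (\<lambda>z. f z + g z) n = taylor_coeff f n + taylor_coeff g n" for n
    using assms higher_deriv_add[of f "ball 0 1" g 0 n]
    by (simp add: hardy_set_def taylor_coeff_def add_divide_distrib)
  then show "taylor_coeff (\<lambda>z. f z + g z) n = taylor_coeff f n + taylor_coeff g n" .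
  show "(\<lambda>z. f z + g z) \<in> hardy_set"
    using assms
    by (auto simp: hardy_set_def * intro!: holomorphic_intros square_summable_add)
qed

lemma hardy_set_cmult:
  assumes "f \<in> hardy_set"
  shows "(\<lambda>z. c * f z) \<in> hardy_set"
    and "taylor_coeff (\<lambda>z. c * f z) n = c * taylor_coeff f n"
proof -
  have *: "taylor_coeff (\<lambda>z. c * f z) n = c * taylor_coeff f n" for n
    using assms higher_deriv_cmult[of f "ball 0 1" 0 n c]
    by (simp add: hardy_set_def taylor_coeff_def)
  then show "taylor_coeff (\<lambda>z. c * f z) n = c * taylor_coeff f n" .
  show "(\<lambda>z. c * f z) \<in> hardy_set"
    using assms
    by (auto simp only: hardy_set_def * mem_Collect_eq
        intro!: holomorphic_intros square_summable_cmult) auto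
qed

instantiation hardy :: real_vector
begin

definition zero_hardy :: hardy where
  "0 = Abs_hardy (\<lambda>_. 0)"

definition plus_hardy :: "hardy \<Rightarrow> hardy \<Rightarrow> hardy" where
  "f + g = Abs_hardy (\<lambda>z. h2_fun f z + h2_fun g z)"

definition uminus_hardy :: "hardy \<Rightarrow> hardy" where
  "- f = Abs_hardy (\<lambda>z. - h2_fun f z)"

definition minus_hardy :: "hardy \<Rightarrow> hardy \<Rightarrow> hardy" where
  "f - g = Abs_hardy (\<lambda>z. h2_fun f z - h2_fun g z)"

definition scaleR_hardy :: "real \<Rightarrow> hardy \<Rightarrow> hardy" where
  "r *\<^sub>R f = Abs_hardy (\<lambda>z. complex_of_real r * h2_fun f z)"

lemma h2_fun_zero [simp]: "h2_fun 0 z = 0"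
  by (simp add: zero_hardy_def Abs_hardy_inverse hardy_set_def)

lemma h2_fun_add [simp]: "h2_fun (f + g) z = h2_fun f z + h2_fun g z"
  by (simp add: plus_hardy_def Abs_hardy_inverse hardy_set_add h2_fun)

lemma h2_fun_uminus [simp]: "h2_fun (- f) z = - h2_fun f z"
  using hardy_set_cmult(1)[OF h2_fun[of f], of "-1"]
  by (simp add: uminus_hardy_def Abs_hardy_inverse)

lemma h2_fun_diff [simp]: "h2_fun (f - g) z = h2_fun f z - h2_fun g z"
  using hardy_set_add(1)[OF h2_fun[of f] hardy_set_cmult(1)[OF h2_fun[of g], of "-1"]]
  by (simp add: minus_hardy_def Abs_hardy_inverse)

lemma h2_fun_scaleR [simp]: "h2_fun (r *\<^sub>R f) z = complex_of_real r * h2_fun f z"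
  by (simp add: scaleR_hardy_def Abs_hardy_inverse hardy_set_cmult h2_fun)

lemma hardy_fun_eqI: "(\<And>z. h2_fun f z = h2_fun g z) \<Longrightarrow> f = g"
  by (metis h2_fun_inject ext)

instance
proof
  fix f g h :: hardy and r s :: real
  show "f + g + h = f + (g + h)" "f + g = g + f" "0 + f = f" "- f + f = 0" "f - g = f + - g"
    "r *\<^sub>R (f + g) = r *\<^sub>R f + r *\<^sub>R g" "(r + s) *\<^sub>R f = r *\<^sub>R f + s *\<^sub>R f"
    "r *\<^sub>R s *\<^sub>R f = (r * s) *\<^sub>R f" "1 *\<^sub>R f = f"
    by (rule hardy_fun_eqI; simp add: algebra_simps)+
qed

end

lemma h2_coeff_zero [simp]: "h2_coeff 0 n = 0"
proof -
  have "h2_fun 0 = (\<lambda>_. 0)" by (rule ext) simp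
  then show ?thesis by (simp add: h2_coeff_def)
qed

lemma h2_coeff_add [simp]: "h2_coeff (f + g) n = h2_coeff f n + h2_coeff g n"
proof -
  have "h2_fun (f + g) = (\<lambda>z. h2_fun f z + h2_fun g z)" by (rule ext) simp
  then show ?thesis by (simp add: h2_coeff_def hardy_set_add h2_fun)
qed

lemma h2_coeff_scaleR [simp]: "h2_coeff (r *\<^sub>R f) n = complex_of_real r * h2_coeff f n"
proof -
  have "h2_fun (r *\<^sub>R f) = (\<lambda>z. complex_of_real r * h2_fun f z)" by (rule ext) simp
  then show ?thesis by (simp add: h2_coeff_def hardy_set_cmult h2_fun)
qed

lemma h2_coeff_diff [simp]: "h2_coeff (f - g) n = h2_coeff f n - h2_coeff g n"
proof -
  have "h2_fun (f - g) = (\<lambda>z. h2_fun f z + - 1 * h2_fun g z)" by (rule ext) simp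
  then show ?thesis
    by (simp only: h2_coeff_def hardy_set_add hardy_set_cmult h2_fun) simp
qed

lemma h2_inner_summable: "summable (\<lambda>n. h2_coeff f n * cnj (h2_coeff g n))"
  by (rule summable_norm_cancel, rule square_summable_prod) (simp_all add: h2_coeff_summable)

instantiation hardy :: real_inner
begin

definition inner_hardy :: "hardy \<Rightarrow> hardy \<Rightarrow> real" where
  "inner f g = Re (\<Sum>n. h2_coeff f n * cnj (h2_coeff g n))"

definition norm_hardy :: "hardy \<Rightarrow> real" where
  "norm f = sqrt (\<Sum>n. (cmod (h2_coeff f n))\<^sup>2)"

definition sgn_hardy :: "hardy \<Rightarrow> hardy" where
  "sgn (f::hardy) = f /\<^sub>R norm f"

definition dist_hardy :: "hardy \<Rightarrow> hardy \<Rightarrow> real" where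
  "dist (f::hardy) g = norm (f - g)"

definition uniformity_hardy :: "(hardy \<times> hardy) filter" where
  "uniformity = (INF e\<in>{0<..}. principal {(f::hardy, g). dist f g < e})"

definition open_hardy :: "hardy set \<Rightarrow> bool" where
  "open (U::hardy set) \<longleftrightarrow> (\<forall>x\<in>U. eventually (\<lambda>(x', y). x' = x \<longrightarrow> y \<in> U) uniformity)"

lemma inner_hardy_self: "inner f f = (\<Sum>n. (cmod (h2_coeff f n))\<^sup>2)"
proof -
  have "inner f f = (\<Sum>n. Re (h2_coeff f n * cnj (h2_coeff f n)))"
    unfolding inner_hardy_def by (rule Re_suminf[OF h2_inner_summable])
  then show ?thesis by (simp add: complex_mult_cnj cmod_power2)
qed

instance
proof
  fix f g h :: hardy and r s :: real
  show "sgn f = f /\<^sub>R norm f" "dist f g = norm (f - g)"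
    by (simp_all add: sgn_hardy_def dist_hardy_def)
  show "uniformity = (INF e\<in>{0<..}. principal {(f :: hardy, g). dist f g < e})"
    by (rule uniformity_hardy_def)
  show "open U \<longleftrightarrow> (\<forall>x\<in>U. eventually (\<lambda>(x', y). x' = x \<longrightarrow> y \<in> U) uniformity)"
    for U :: "hardy set"
    by (rule open_hardy_def)
  have "inner f g = (\<Sum>n. Re (h2_coeff f n * cnj (h2_coeff g n)))" for f g
    unfolding inner_hardy_def by (rule Re_suminf[OF h2_inner_summable])
  then show "inner f g = inner g f"
    by (simp add: mult.commute)
  show "inner (f + g) h = inner f h + inner g h"
    by (simp add: inner_hardy_def distrib_right suminf_add[OF h2_inner_summable h2_inner_summable, symmetric])
  show "inner (r *\<^sub>R f) g = r * inner f g"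
    by (simp add: inner_hardy_def mult.assoc suminf_mult[OF h2_inner_summable])
  show "0 \<le> inner f f"
    by (simp add: inner_hardy_self suminf_nonneg h2_coeff_summable)
  show "inner f f = 0 \<longleftrightarrow> f = 0"
    using suminf_eq_zero_iff[OF h2_coeff_summable[of f]]
    by (auto simp: inner_hardy_self intro: hardy_eqI)
  show "norm f = sqrt (inner f f)"
    by (simp add: norm_hardy_def inner_hardy_self)
qed

end

lemma norm_hardy_power2: "(norm (f::hardy))\<^sup>2 = (\<Sum>n. (cmod (h2_coeff f n))\<^sup>2)"
  by (simp add: norm_hardy_def suminf_nonneg h2_coeff_summable)

lemma hardy_partial_sum_le: "(\<Sum>n<m. (cmod (h2_coeff f n))\<^sup>2) \<le> (norm f)\<^sup>2"
  unfolding norm_hardy_power2 by (rule sum_le_suminf[OF h2_coeff_summable]) auto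

lemma norm_h2_coeff_le: "cmod (h2_coeff f n) \<le> norm f"
proof -
  have "(cmod (h2_coeff f n))\<^sup>2 \<le> (\<Sum>k<Suc n. (cmod (h2_coeff f k))\<^sup>2)"
    by (simp add: sum_nonneg)
  also have "\<dots> \<le> (norm f)\<^sup>2" by (rule hardy_partial_sum_le)
  finally show ?thesis by (rule power2_le_imp_le) simp
qed

instance hardy :: complete_space
proof
  fix X :: "nat \<Rightarrow> hardy"
  assume X: "Cauchy X"
  have "Cauchy (\<lambda>k. h2_coeff (X k) n)" for n
  proof (rule CauchyI)
    fix e :: real assume "e > 0"
    then obtain M where M: "\<And>j k. j \<ge> M \<Longrightarrow> k \<ge> M \<Longrightarrow> norm (X j - X k) < e"
      using CauchyD[OF X] by blast
    have "cmod (h2_coeff (X j) n - h2_coeff (X k) n) < e" if "j \<ge> M" "k \<ge> M" for j k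
      using norm_h2_coeff_le[of "X j - X k" n] M[OF that] by simp
    then show "\<exists>M. \<forall>j\<ge>M. \<forall>k\<ge>M. cmod (h2_coeff (X j) n - h2_coeff (X k) n) < e" by blast
  qed
  then have "\<exists>a. (\<lambda>k. h2_coeff (X k) n) \<longlonglongrightarrow> a" for n
    by (simp add: Cauchy_convergent_iff convergent_def)
  then obtain a where a: "\<And>n. (\<lambda>k. h2_coeff (X k) n) \<longlonglongrightarrow> a n" by metis
  have part: "(\<Sum>n<m. (cmod (h2_coeff (X j) n - a n))\<^sup>2) \<le> e\<^sup>2"
    if M: "\<And>j k. j \<ge> M \<Longrightarrow> k \<ge> M \<Longrightarrow> norm (X j - X k) < e" and j: "j \<ge> M" for e M j m
  proof (rule tendsto_upperbound)
    show "(\<lambda>k. \<Sum>n<m. (cmod (h2_coeff (X j) n - h2_coeff (X k) n))\<^sup>2)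
            \<longlonglongrightarrow> (\<Sum>n<m. (cmod (h2_coeff (X j) n - a n))\<^sup>2)"
      by (intro tendsto_intros a)
    show "eventually (\<lambda>k. (\<Sum>n<m. (cmod (h2_coeff (X j) n - h2_coeff (X k) n))\<^sup>2) \<le> e\<^sup>2) sequentially"
      using eventually_ge_at_top[of M]
    proof eventually_elim
      case (elim k)
      have "(\<Sum>n<m. (cmod (h2_coeff (X j - X k) n))\<^sup>2) \<le> (norm (X j - X k))\<^sup>2"
        by (rule hardy_partial_sum_le)
      also have "\<dots> \<le> e\<^sup>2"
        using M[OF j elim] by (intro power_mono) auto
      finally show ?case by simp
    qed
  qed simp
  have sq: "summable (\<lambda>n. (cmod (h2_coeff (X j) n - a n))\<^sup>2) \<and>
            (\<Sum>n. (cmod (h2_coeff (X j) n - a n))\<^sup>2) \<le> e\<^sup>2"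
    if M: "\<And>j k. j \<ge> M \<Longrightarrow> k \<ge> M \<Longrightarrow> norm (X j - X k) < e" and j: "j \<ge> M" for e M j
  proof -
    have s: "summable (\<lambda>n. (cmod (h2_coeff (X j) n - a n))\<^sup>2)"
      by (rule summableI_nonneg_bounded[OF _ part[OF M j]]) auto
    then show ?thesis using part[OF M j] by (auto intro: suminf_le_const)
  qed
  obtain M where "\<And>j k. j \<ge> M \<Longrightarrow> k \<ge> M \<Longrightarrow> norm (X j - X k) < 1"
    using CauchyD[OF X, of 1] by auto
  from sq[OF this] have "summable (\<lambda>n. (cmod (h2_coeff (X M) n - a n))\<^sup>2)" by auto
  from square_summable_add[OF h2_coeff_summable[of "X M"] square_summable_cmult[OF this, of "-1"]]
  have "summable (\<lambda>n. (cmod (a n))\<^sup>2)" by simp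
  then obtain L where L: "\<And>n. h2_coeff L n = a n" by (rule hardy_of_coeffs) blast
  have "X \<longlonglongrightarrow> L"
  proof (rule LIMSEQ_I)
    fix e :: real assume e: "e > 0"
    then obtain M where M: "\<And>j k. j \<ge> M \<Longrightarrow> k \<ge> M \<Longrightarrow> norm (X j - X k) < e / 2"
      using CauchyD[OF X, of "e / 2"] by auto
    have "norm (X j - L) < e" if "j \<ge> M" for j
    proof -
      have "(norm (X j - L))\<^sup>2 \<le> (e / 2)\<^sup>2"
        using sq[OF M that] by (simp add: norm_hardy_power2 L)
      then have "norm (X j - L) \<le> e / 2" by (rule power2_le_imp_le) (use e in simp)
      then show ?thesis using e by simp
    qed
    then show "\<exists>M. \<forall>j\<ge>M. norm (X j - L) < e" by blast
  qed
  then show "convergent X" by (auto simp: convergent_def)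
qed

instantiation hardy :: complex_hilbert_space
begin

definition scaleC_hardy :: "complex \<Rightarrow> hardy \<Rightarrow> hardy" where
  "c *\<^sub>C f = Abs_hardy (\<lambda>z. c * h2_fun f z)"

definition cinner_hardy :: "hardy \<Rightarrow> hardy \<Rightarrow> complex" where
  "cinner f g = (\<Sum>n. h2_coeff f n * cnj (h2_coeff g n))"

lemma h2_fun_scaleC [simp]: "h2_fun (c *\<^sub>C f) z = c * h2_fun f z"
  by (simp add: scaleC_hardy_def Abs_hardy_inverse hardy_set_cmult h2_fun)

lemma h2_coeff_scaleC [simp]: "h2_coeff (c *\<^sub>C f) n = c * h2_coeff f n"
proof -
  have "h2_fun (c *\<^sub>C f) = (\<lambda>z. c * h2_fun f z)" by (rule ext) simp
  then show ?thesis by (simp add: h2_coeff_def hardy_set_cmult h2_fun)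
qed

instance
proof
  fix f g h :: hardy and b c :: complex and r :: real
  show "c *\<^sub>C (f + g) = c *\<^sub>C f + c *\<^sub>C g" "(b + c) *\<^sub>C f = b *\<^sub>C f + c *\<^sub>C f"
    "b *\<^sub>C c *\<^sub>C f = (b * c) *\<^sub>C f" "complex_of_real r *\<^sub>C f = r *\<^sub>R f"
    by (rule hardy_fun_eqI; simp add: algebra_simps)+
  have "(\<lambda>n. cnj (h2_coeff g n * cnj (h2_coeff f n))) sums cnj (cinner g f)"
    unfolding cinner_hardy_def sums_cnj by (rule summable_sums[OF h2_inner_summable])
  then show "cinner f g = cnj (cinner g f)"
    by (simp add: cinner_hardy_def mult.commute sums_iff)
  show "cinner (f + g) h = cinner f h + cinner g h"
    by (simp add: cinner_hardy_def distrib_right suminf_add[OF h2_inner_summable h2_inner_summable])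
  show "cinner (c *\<^sub>C f) g = c * cinner f g"
    by (simp add: cinner_hardy_def mult.assoc suminf_mult[OF h2_inner_summable])
  show "inner f g = Re (cinner f g)"
    by (simp add: inner_hardy_def cinner_hardy_def)
qed

end

text \<open>
  The function passed to \<open>Abs_hardy\<close> is in \<open>H\<^sup>2\<close> for every analytic selfmap \<open>\<phi>\<close> of the disk
  (Littlewood's subordination principle).
\<close>

definition composition_op :: "(complex \<Rightarrow> complex) \<Rightarrow> hardy \<Rightarrow> hardy" where
  "composition_op \<phi> f = Abs_hardy (\<lambda>z. if z \<in> ball 0 1 then h2_fun f (\<phi> z) else 0)"


section \<open>Linear-fractional maps of the extended plane\<close>

datatype ecomplex = Fin complex | Infty

text \<open>
  The map is a bijection when \<open>a * d - b * c \<noteq> 0\<close>: the numerator is then nonzero wherever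
  the denominator vanishes, and \<open>a \<noteq> 0\<close> if \<open>c = 0\<close>.
\<close>

fun lft :: "complex \<Rightarrow> complex \<Rightarrow> complex \<Rightarrow> complex \<Rightarrow> ecomplex \<Rightarrow> ecomplex" where
  "lft a b c d (Fin z) = (if c * z + d = 0 then Infty else Fin ((a * z + b) / (c * z + d)))"
| "lft a b c d Infty = (if c = 0 then Infty else Fin (a / c))"

fun ecnj :: "ecomplex \<Rightarrow> ecomplex" where
  "ecnj (Fin z) = Fin (cnj z)"
| "ecnj Infty = Infty"

fun einverse :: "ecomplex \<Rightarrow> ecomplex" where
  "einverse (Fin z) = (if z = 0 then Infty else Fin (1 / z))"
| "einverse Infty = Fin 0"

definition edisk :: "ecomplex set" where
  "edisk = Fin ` ball 0 1"

end

theory Submission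
  imports Defs
begin

text \<open>
  Write \<open>A = C\<^sub>\<phi>\<close>, let \<open>K\<^sub>w\<close> be the reproducing kernels and \<open>\<tau> = \<sigma> \<circ> \<phi>\<inverse>\<close>. By Douglas' lemma
  coposinormality means that the range of \<open>A\<^sup>*\<close> lies in the range of \<open>A\<close>. As \<open>A\<^sup>* K\<^sub>w = K\<^sub>u\<close> with
  \<open>u = \<phi>(w)\<close>, it forces the linear-fractional map \<open>K\<^sub>u \<circ> \<phi>\<inverse>\<close> to be the restriction of an
  \<open>H\<^sup>2\<close> function, so its pole \<open>\<phi>(1 / cnj u)\<close> is not in the disk; this is (b). On the coefficient
  matrices, (b) and (c) say that a linear-fractional map and its adjoint are selfmaps of the disk, and
  taking adjoints preserves this property. If \<open>\<tau>\<close> is a selfmap, Cowen's formula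
  \<open>A\<^sup>* = M\<^sub>g C\<^sub>\<sigma> M\<^sub>h\<^sup>*\<close>, where \<open>g = 1 / (- cnj b z + cnj d)\<close> and
  \<open>h = c z + d\<close>, and \<open>\<sigma> = \<tau> \<circ> \<phi>\<close> give \<open>A\<^sup>* = A B\<close> with the bounded operator
  \<open>B = M\<^sub>\<psi> C\<^sub>\<tau> M\<^sub>h\<^sup>*\<close>, \<open>\<psi> = g \<circ> \<phi>\<inverse>\<close>, and \<open>P = B B\<^sup>*\<close> works.
\<close>

section \<open>Complex Hilbert spaces\<close>

lemma cinner_add_right: "cinner x (y + z) = cinner x y + cinner x z"
  by (metis cinner_add_left cinner_commute complex_cnj_add)

lemma cinner_scaleC_right: "cinner x (c *\<^sub>C y) = cnj c * cinner x y"
  by (metis cinner_commute cinner_scaleC_left complex_cnj_mult)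

lemma scaleC_0_left [simp]: "0 *\<^sub>C x = (0::'a::complex_hilbert_space)"
  using scaleC_of_real[of 0 x] by simp

lemma cinner_0_left [simp]: "cinner 0 y = 0"
  using cinner_scaleC_left[of 0 0 y] by simp

lemma cinner_self: "cinner x x = complex_of_real ((norm x)\<^sup>2)"
proof (rule complex_eqI)
  show "Re (cinner x x) = Re (complex_of_real ((norm x)\<^sup>2))"
    by (simp add: power2_norm_eq_inner inner_eq_Re_cinner flip: of_real_power)
  show "Im (cinner x x) = Im (complex_of_real ((norm x)\<^sup>2))"
    using arg_cong[OF cinner_commute[of x x], of Im] by (simp flip: of_real_power)
qed

lemma norm_scaleC: "norm (c *\<^sub>C x) = cmod c * norm (x::'a::complex_hilbert_space)"
proof -
  have "complex_of_real ((norm (c *\<^sub>C x))\<^sup>2) = complex_of_real ((cmod c * norm x)\<^sup>2)"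
    unfolding cinner_self[symmetric] cinner_scaleC_left cinner_scaleC_right
    by (simp add: cinner_self power_mult_distrib mult_ac flip: complex_norm_square)
  then have "(norm (c *\<^sub>C x))\<^sup>2 = (cmod c * norm x)\<^sup>2"
    unfolding of_real_eq_iff .
  then show ?thesis by (rule power2_eq_imp_eq) auto
qed

lemma cmod_cinner_le: "cmod (cinner x y) \<le> norm x * norm y"
proof (cases "cinner x y = 0")
  case False
  \<comment> \<open>Rotating \<open>x\<close> by a unimodular scalar makes the inner product a
    nonnegative real, which reduces the bound to the real Cauchy-Schwarz inequality.\<close>
  define c where "c = cnj (sgn (cinner x y))"
  have c: "cmod c = 1" using False by (simp add: c_def norm_sgn)
  have "c * cinner x y = complex_of_real (cmod (cinner x y))"
    using False complex_norm_square[of "cinner x y"]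
    by (simp add: c_def sgn_eq field_simps power2_eq_square)
  then have "cmod (cinner x y) = Re (cinner (c *\<^sub>C x) y)"
    by (simp add: cinner_scaleC_left)
  also have "\<dots> \<le> norm (c *\<^sub>C x) * norm y"
    by (metis inner_eq_Re_cinner norm_cauchy_schwarz)
  finally show ?thesis by (simp add: norm_scaleC c)
qed simp

lemma norm_add_power2: "(norm (x + y))\<^sup>2 = (norm x)\<^sup>2 + (norm y)\<^sup>2 + 2 * Re (cinner x y)"
  by (simp add: power2_norm_eq_inner inner_add_left inner_add_right inner_commute
      flip: inner_eq_Re_cinner)

lemma cinner_eqI:
  assumes "\<And>z. cinner z x = cinner z y"
  shows "x = y"
proof -
  have "inner (x - y) (x - y) = 0"
    unfolding inner_diff_right[of "x - y"] by (simp only: inner_eq_Re_cinner assms diff_self)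
  then show ?thesis by simp
qed

lemma bounded_clinearI:
  assumes "\<And>x y. A (x + y) = A x + A y" "\<And>c x. A (c *\<^sub>C x) = c *\<^sub>C A x"
    and "\<And>x. norm (A x) \<le> C * norm x"
  shows "bounded_clinear A"
  unfolding bounded_clinear_def
proof
  show "bounded_linear A"
    using assms by (intro bounded_linear_intro[of A C]) (auto simp: mult.commute simp flip: scaleC_of_real)
qed (use assms in auto)

lemma bounded_clinear_bounded_linear: "bounded_clinear A \<Longrightarrow> bounded_linear A"
  by (simp add: bounded_clinear_def)

lemma bounded_clinear_scaleC: "bounded_clinear A \<Longrightarrow> A (c *\<^sub>C x) = c *\<^sub>C A x"
  by (simp add: bounded_clinear_def)

lemma bounded_clinear_add: "bounded_clinear A \<Longrightarrow> A (x + y) = A x + A y"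
  by (simp add: bounded_clinear_def bounded_linear.linear linear_add)

lemma bounded_clinear_comp:
  "bounded_clinear A \<Longrightarrow> bounded_clinear B \<Longrightarrow> bounded_clinear (A \<circ> B)"
  by (auto simp: bounded_clinear_def comp_def intro: bounded_linear_compose)

text \<open>
  Minimising \<open>\<parallel>y\<parallel>\<^sup>2 - 2 L y\<close> over the subspace gives the representing vector at once, without
  orthogonal projections.
\<close>

lemma riesz_subspace:
  fixes L :: "'a::{real_inner, complete_space} \<Rightarrow> real"
  assumes W: "subspace W"
    and add: "\<And>x y. x \<in> W \<Longrightarrow> y \<in> W \<Longrightarrow> L (x + y) = L x + L y"
    and scale: "\<And>r x. x \<in> W \<Longrightarrow> L (r *\<^sub>R x) = r * L x"
    and bound: "\<And>x. x \<in> W \<Longrightarrow> \<bar>L x\<bar> \<le> C * norm x"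
  obtains f where "\<And>y. y \<in> W \<Longrightarrow> inner y f = L y"
proof -
  define Q where "Q y = inner y y - 2 * L y" for y
  have lower: "- C\<^sup>2 \<le> Q y" if "y \<in> W" for y
  proof -
    have "0 \<le> (norm y - C)\<^sup>2" by simp
    then show ?thesis
      using bound[OF that] by (simp add: Q_def power2_diff dot_square_norm mult.commute)
  qed
  define m where "m = Inf (Q ` W)"
  have ne: "Q ` W \<noteq> {}" using subspace_0[OF W] by auto
  have bdd: "bdd_below (Q ` W)" using lower by (auto intro!: bdd_belowI)
  have m_le: "m \<le> Q y" if "y \<in> W" for y
    unfolding m_def using that bdd by (auto intro: cINF_lower)
  have "\<exists>y\<in>W. Q y < m + inverse (real (Suc n))" for n
    using cINF_less_iff[OF _ bdd, of "m + inverse (real (Suc n))"] ne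
    by (auto simp: m_def)
  then obtain Y where Y: "\<And>n. Y n \<in> W" "\<And>n. Q (Y n) < m + inverse (real (Suc n))"
    by metis
  have Qlim: "(\<lambda>n. Q (Y n)) \<longlonglongrightarrow> m"
  proof (rule tendsto_sandwich[of "\<lambda>_. m" _ _ "\<lambda>n. m + inverse (real (Suc n))"])
    show "(\<lambda>n. m + inverse (real (Suc n))) \<longlonglongrightarrow> m"
      using tendsto_add[OF tendsto_const LIMSEQ_inverse_real_of_nat, of m] by simp
  qed (use Y m_le in \<open>auto intro!: always_eventually intro: less_imp_le simp del: of_nat_Suc\<close>)
  \<comment> \<open>The midpoint of \<open>x\<close> and \<open>y\<close> lies in \<open>W\<close>,
    so \<open>Q\<close> is at least \<open>m\<close> there; by the parallelogram law near-minimisers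
    are close to each other.\<close>
  have par: "(norm (x - y))\<^sup>2 \<le> 2 * (Q x + Q y - 2 * m)" if "x \<in> W" "y \<in> W" for x y
  proof -
    have "m \<le> Q ((1/2) *\<^sub>R (x + y))"
      using that W by (intro m_le) (auto intro: subspace_add subspace_scale)
    then have "m \<le> (2 * inner x y + (inner x x + inner y y)) / 4 - (L x + L y)"
      using that W
      by (simp add: Q_def scale add subspace_add inner_add_left inner_add_right inner_commute add_divide_distrib)
    moreover have "(norm (x - y))\<^sup>2 = inner x x + inner y y - 2 * inner x y"
      by (simp add: power2_norm_eq_inner inner_diff_left inner_diff_right inner_commute)
    ultimately show ?thesis unfolding Q_def by argo
  qed
  have "Cauchy Y"
  proof (rule metric_CauchyI)
    fix e :: real assume "e > 0"
    then have "eventually (\<lambda>n. Q (Y n) < m + e\<^sup>2 / 4) sequentially"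
      using Qlim by (intro order_tendstoD) auto
    then obtain M where M: "\<And>n. n \<ge> M \<Longrightarrow> Q (Y n) < m + e\<^sup>2 / 4"
      by (auto simp: eventually_sequentially)
    have "dist (Y j) (Y k) < e" if "j \<ge> M" "k \<ge> M" for j k
    proof -
      have "(norm (Y j - Y k))\<^sup>2 < e\<^sup>2"
        using par[OF Y(1) Y(1), of j k] M[OF that(1)] M[OF that(2)] by argo
      then show ?thesis using \<open>e > 0\<close> by (simp add: dist_norm power2_less_imp_less)
    qed
    then show "\<exists>M. \<forall>j\<ge>M. \<forall>k\<ge>M. dist (Y j) (Y k) < e" by blast
  qed
  then obtain f where f: "Y \<longlonglongrightarrow> f" using Cauchy_convergent convergent_def by blast
  have "inner y f = L y" if y: "y \<in> W" for y
  proof (cases "y = 0")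
    case True
    then show ?thesis using scale[OF y, of 0] by simp
  next
    case False
    define r where "r = inner y f - L y"
    \<comment> \<open>First variation. The limit \<open>f\<close> may leave \<open>W\<close>, where
      \<open>L\<close> is not controlled, so \<open>Q\<close> is estimated at the points
      \<open>Y n + t y\<close> of \<open>W\<close> and the limit is taken afterwards.\<close>
    have "0 \<le> 2 * t * r + t\<^sup>2 * inner y y" for t
    proof -
      have "(\<lambda>n. Q (Y n) + 2 * t * (inner y (Y n) - L y) + t\<^sup>2 * inner y y)
              \<longlonglongrightarrow> m + 2 * t * (inner y f - L y) + t\<^sup>2 * inner y y"
        by (intro tendsto_intros Qlim f)
      moreover have "m \<le> Q (Y n) + 2 * t * (inner y (Y n) - L y) + t\<^sup>2 * inner y y" for n
        using m_le[of "Y n + t *\<^sub>R y"] Y(1)[of n] y W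
        by (simp add: Q_def add scale subspace_add subspace_scale inner_add_left inner_add_right
            inner_commute power2_eq_square algebra_simps)
      ultimately have "m \<le> m + 2 * t * (inner y f - L y) + t\<^sup>2 * inner y y"
        by (intro tendsto_lowerbound[where F = sequentially]) auto
      then show ?thesis by (simp add: r_def)
    qed
    from this[of "- r / inner y y"] have "r\<^sup>2 / inner y y \<le> 0"
      using False by (simp add: field_simps power2_eq_square)
    then have "r = 0" using inner_gt_zero_iff[of y] False by (auto simp: divide_le_0_iff simp del: inner_gt_zero_iff)
    then show ?thesis by (simp add: r_def)
  qed
  then show ?thesis by (rule that)
qed

lemma riesz_csubspace:
  fixes L :: "'a::complex_hilbert_space \<Rightarrow> complex"
  assumes W: "\<And>x y. x \<in> W \<Longrightarrow> y \<in> W \<Longrightarrow> x + y \<in> W" "\<And>c x. x \<in> W \<Longrightarrow> c *\<^sub>C x \<in> W" "0 \<in> W"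
    and add: "\<And>x y. x \<in> W \<Longrightarrow> y \<in> W \<Longrightarrow> L (x + y) = L x + L y"
    and scale: "\<And>c x. x \<in> W \<Longrightarrow> L (c *\<^sub>C x) = c * L x"
    and bound: "\<And>x. x \<in> W \<Longrightarrow> cmod (L x) \<le> C * norm x"
  obtains f where "\<And>y. y \<in> W \<Longrightarrow> cinner y f = L y"
proof -
  obtain f where f: "\<And>y. y \<in> W \<Longrightarrow> inner y f = Re (L y)"
  proof (rule riesz_subspace[where W = W and L = "\<lambda>x. Re (L x)" and C = C])
    show "subspace W" using W by (auto simp: subspace_def simp flip: scaleC_of_real)
    show "\<bar>Re (L x)\<bar> \<le> C * norm x" if "x \<in> W" for x
      using bound[OF that] abs_Re_le_cmod order_trans by blast
  qed (auto simp: add scale simp flip: scaleC_of_real)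
  \<comment> \<open>A complex-linear functional is determined by its real part; testing at
    \<open>\<i> *\<^sub>C y\<close> recovers the imaginary part.\<close>
  have "cinner y f = L y" if y: "y \<in> W" for y
    using f[OF y] f[OF W(2)[OF y, of \<i>]] scale[OF y, of \<i>]
    by (simp add: complex_eq_iff inner_eq_Re_cinner cinner_scaleC_left)
  then show ?thesis by (rule that)
qed

section \<open>Adjoints of bounded operators\<close>

lemma cadjointI:
  assumes "\<And>x y. cinner (A x) y = cinner x (B y)"
  shows "cadjoint A = B"
  unfolding cadjoint_def
proof (rule the_equality)
  fix B' assume "\<forall>x y. cinner (A x) y = cinner x (B' y)"
  then show "B' = B" using assms by (intro ext cinner_eqI) metis
qed (use assms in blast)

lemma bounded_clinear_bound:
  assumes "bounded_clinear A"
  obtains C where "C \<ge> 0" "\<And>x. norm (A x) \<le> C * norm x"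
  using bounded_linear.nonneg_bounded[OF bounded_clinear_bounded_linear[OF assms]]
  by (auto simp: mult.commute)

text \<open>Riesz representation of \<open>x \<mapsto> cinner (A x) y\<close> on the whole space
  produces an adjoint, so the definite description in \<open>cadjoint\<close> denotes.\<close>

lemma cinner_cadjoint:
  assumes A: "bounded_clinear A"
  shows "cinner (A x) y = cinner x (cadjoint A y)"
proof -
  obtain C where C: "C \<ge> 0" "\<And>x. norm (A x) \<le> C * norm x"
    by (rule bounded_clinear_bound[OF A]) blast
  have "\<exists>z. \<forall>x. cinner (A x) y = cinner x z" for y
  proof -
    obtain f where "\<And>x. x \<in> UNIV \<Longrightarrow> cinner x f = cinner (A x) y"
    proof (rule riesz_csubspace[where W = UNIV and C = "C * norm y"])
      fix x
      have "cmod (cinner (A x) y) \<le> norm (A x) * norm y" by (rule cmod_cinner_le)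
      also have "\<dots> \<le> C * norm x * norm y" using C by (intro mult_right_mono) auto
      finally show "cmod (cinner (A x) y) \<le> C * norm y * norm x" by (simp add: mult_ac)
    qed (auto simp: bounded_clinear_add[OF A] bounded_clinear_scaleC[OF A]
        cinner_add_left cinner_scaleC_left)
    then show ?thesis by (intro exI[of _ f]) simp
  qed
  then obtain B where B: "\<And>x y. cinner (A x) y = cinner x (B y)" by metis
  show ?thesis unfolding cadjointI[OF B] by (rule B)
qed

lemma cinner_cadjoint_left:
  assumes A: "bounded_clinear A"
  shows "cinner (cadjoint A x) y = cinner x (A y)"
  using cinner_cadjoint[OF A, of y x] by (metis cinner_commute)

lemma bounded_clinear_cadjoint:
  assumes A: "bounded_clinear A"
  shows "bounded_clinear (cadjoint A)"
proof -
  note adj = cinner_cadjoint[OF A, symmetric]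
  obtain C where C: "C \<ge> 0" "\<And>x. norm (A x) \<le> C * norm x"
    by (rule bounded_clinear_bound[OF A]) blast
  show ?thesis
  proof (rule bounded_clinearI[where C = C])
    show "cadjoint A (x + y) = cadjoint A x + cadjoint A y" for x y
      by (rule cinner_eqI) (simp add: adj cinner_add_right)
    show "cadjoint A (c *\<^sub>C x) = c *\<^sub>C cadjoint A x" for c x
      by (rule cinner_eqI) (simp add: adj cinner_scaleC_right)
    show "norm (cadjoint A y) \<le> C * norm y" for y
    proof -
      let ?z = "cadjoint A y"
      have "(norm ?z)\<^sup>2 = cmod (cinner ?z ?z)" by (simp add: cinner_self del: of_real_power)
      also have "\<dots> = cmod (cinner (A ?z) y)" by (simp add: adj)
      also have "\<dots> \<le> norm (A ?z) * norm y" by (rule cmod_cinner_le)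
      also have "\<dots> \<le> C * norm ?z * norm y" using C by (intro mult_right_mono) auto
      finally have "norm ?z * norm ?z \<le> norm ?z * (C * norm y)"
        by (simp add: power2_eq_square mult_ac)
      then show ?thesis using C(1)
        by (cases "norm ?z = 0") (auto dest: mult_left_le_imp_le)
    qed
  qed
qed

lemma cadjoint_cadjoint:
  assumes A: "bounded_clinear A"
  shows "cadjoint (cadjoint A) = A"
  by (rule cadjointI) (rule cinner_cadjoint_left[OF A])

section \<open>Coposinormality and range inclusion\<close>

lemma coposinormal_iff:
  assumes A: "bounded_clinear A"
  shows "coposinormal A \<longleftrightarrow>
    (\<exists>P. positive_operator P \<and> cadjoint A \<circ> A = A \<circ> P \<circ> cadjoint A)"
  by (simp add: coposinormal_def posinormal_def A bounded_clinear_cadjoint cadjoint_cadjoint)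

text \<open>Passing to adjoints turns \<open>cadjoint A = A \<circ> B\<close> into
  \<open>A = cadjoint B \<circ> cadjoint A\<close>, so \<open>B \<circ> cadjoint B\<close> serves as
  the positive operator.\<close>

lemma coposinormalI:
  assumes A: "bounded_clinear A" and B: "bounded_clinear B"
    and AB: "cadjoint A = A \<circ> B"
  shows "coposinormal A"
  unfolding coposinormal_iff[OF A]
proof (intro exI conjI)
  have eq: "A x = cadjoint B (cadjoint A x)" for x
  proof (rule cinner_eqI)
    fix z
    have "cinner z (A x) = cinner (A (B z)) x"
      using cinner_cadjoint_left[OF A, of z x] by (simp add: AB)
    then show "cinner z (A x) = cinner z (cadjoint B (cadjoint A x))"
      by (simp add: cinner_cadjoint[OF A] cinner_cadjoint[OF B])
  qed
  show "cadjoint A \<circ> A = A \<circ> (B \<circ> cadjoint B) \<circ> cadjoint A"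
  proof
    fix x
    have "cadjoint A (A x) = A (B (A x))" by (simp add: AB)
    also have "\<dots> = A (B (cadjoint B (cadjoint A x)))" by (simp only: eq[of x, symmetric])
    finally show "(cadjoint A \<circ> A) x = (A \<circ> (B \<circ> cadjoint B) \<circ> cadjoint A) x" by simp
  qed
  show "positive_operator (B \<circ> cadjoint B)"
    unfolding positive_operator_def
  proof (intro conjI allI)
    fix x
    show "cinner ((B \<circ> cadjoint B) x) x \<in> \<real>\<^sub>\<ge>\<^sub>0"
      by (simp add: cinner_cadjoint[OF B] cinner_self flip: of_real_power)
  qed (intro bounded_clinear_comp bounded_clinear_cadjoint B)
qed

text \<open>
  One half of Douglas' lemma: \<open>A\<^sup>*A \<le> C A A\<^sup>*\<close> makes \<open>A\<^sup>*x \<mapsto> \<langle>A x, y\<rangle>\<close> a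
  bounded functional on the range of \<open>A\<^sup>*\<close>, and a vector representing it is mapped by \<open>A\<close> to \<open>A\<^sup>*y\<close>.
\<close>

lemma coposinormal_range:
  assumes "coposinormal A"
  obtains f where "A f = cadjoint A y"
proof -
  have A: "bounded_clinear A" using assms by (simp add: coposinormal_def)
  let ?A = "cadjoint A"
  have A': "bounded_clinear ?A" by (rule bounded_clinear_cadjoint[OF A])
  note adj = cinner_cadjoint[OF A]
  obtain P where P: "positive_operator P" and eq: "?A \<circ> A = A \<circ> P \<circ> ?A"
    using assms coposinormal_iff[OF A] by blast
  obtain C where C: "C \<ge> 0" "\<And>x. norm (P x) \<le> C * norm x"
    using bounded_clinear_bound P positive_operator_def by metis
  have le: "norm (A x) \<le> sqrt C * norm (?A x)" for x
  proof -
    have "cinner (A x) (A x) = cinner x (A (P (?A x)))"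
      using fun_cong[OF eq, of x] by (simp add: adj)
    also have "\<dots> = cinner (?A x) (P (?A x))"
      by (simp add: cinner_cadjoint_left[OF A])
    finally have "(norm (A x))\<^sup>2 = cmod (cinner (?A x) (P (?A x)))"
      by (metis abs_norm_cancel abs_power2 cinner_self norm_of_real power2_abs)
    also have "\<dots> \<le> norm (?A x) * norm (P (?A x))" by (rule cmod_cinner_le)
    also have "\<dots> \<le> norm (?A x) * (C * norm (?A x))" using C by (intro mult_left_mono) auto
    also have "\<dots> = (sqrt C * norm (?A x))\<^sup>2" using C by (simp add: power_mult_distrib power2_eq_square mult_ac)
    finally show ?thesis using C by (auto intro: power2_le_imp_le)
  qed
  \<comment> \<open>\<open>inv ?A v\<close> is an arbitrary preimage of \<open>v\<close>. By
    \<open>le\<close> the operator \<open>A\<close> vanishes on the kernel of \<open>?A\<close>, so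
    the value does not depend on the choice.\<close>
  define L where "L v = cinner (A (inv ?A v)) y" for v
  have L: "L (?A x) = cinner (A x) y" for x
  proof -
    let ?x = "inv ?A (?A x)"
    have "?A (?x - x) = 0"
      by (simp add: f_inv_into_f bounded_linear.linear linear_diff
          bounded_clinear_bounded_linear[OF A'])
    then have "A (?x - x) = 0" using le[of "?x - x"] by simp
    then have "A ?x = A x"
      by (simp add: bounded_linear.linear linear_diff bounded_clinear_bounded_linear[OF A])
    then show ?thesis by (simp add: L_def)
  qed
  obtain f where f: "\<And>v. v \<in> range ?A \<Longrightarrow> cinner v f = L v"
  proof (rule riesz_csubspace[where W = "range ?A" and L = L and C = "sqrt C * norm y"])
    show "0 \<in> range ?A"
      by (metis A' bounded_clinear_bounded_linear bounded_linear.linear linear_0 rangeI)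
    show "x + z \<in> range ?A" if "x \<in> range ?A" "z \<in> range ?A" for x z
      using that by (auto simp flip: bounded_clinear_add[OF A'])
    show "c *\<^sub>C x \<in> range ?A" if "x \<in> range ?A" for c x
      using that by (auto simp flip: bounded_clinear_scaleC[OF A'])
    show "L (x + z) = L x + L z" if "x \<in> range ?A" "z \<in> range ?A" for x z
      using that
      by (auto simp: L bounded_clinear_add[OF A] cinner_add_left simp flip: bounded_clinear_add[OF A'])
    show "L (c *\<^sub>C x) = c * L x" if "x \<in> range ?A" for c x
      using that
      by (auto simp: L bounded_clinear_scaleC[OF A] cinner_scaleC_left
          simp flip: bounded_clinear_scaleC[OF A'])
    show "cmod (L x) \<le> sqrt C * norm y * norm x" if "x \<in> range ?A" for x
    proof -
      from that obtain z where z: "x = ?A z" by auto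
      have "cmod (L x) \<le> norm (A z) * norm y" by (simp add: z L cmod_cinner_le)
      also have "\<dots> \<le> sqrt C * norm x * norm y" using le z by (intro mult_right_mono) auto
      finally show ?thesis by (simp add: mult_ac)
    qed
  qed blast
  have "A f = ?A y"
  proof (rule cinner_eqI)
    fix z
    have "cinner z (A f) = cinner (?A z) f" by (simp add: cinner_cadjoint_left[OF A])
    also have "\<dots> = cinner z (?A y)" by (simp add: f L adj)
    finally show "cinner z (A f) = cinner z (?A y)" .
  qed
  then show ?thesis by (rule that)
qed


section \<open>Sums of powers of a contraction\<close>

lemma cmod_add_power2: "(cmod (x + y))\<^sup>2 = (cmod x)\<^sup>2 + (cmod y)\<^sup>2 + 2 * Re (x * cnj y)"
  unfolding cmod_power2 by (simp add: power2_eq_square algebra_simps)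

text \<open>
  With \<open>X\<^sub>n = \<Sum>\<^sub>k f\<^sub>n\<^sub>+\<^sub>k T\<^sup>k e\<close> and \<open>y\<^sub>n = \<langle>X\<^sub>n, e\<rangle>\<close> we have \<open>X\<^sub>n = f\<^sub>n e + T X\<^sub>n\<^sub>+\<^sub>1\<close>
  and \<open>y\<^sub>n = f\<^sub>n + \<alpha> y\<^sub>n\<^sub>+\<^sub>1\<close>, hence \<open>\<parallel>X\<^sub>n\<parallel>\<^sup>2 \<le> |y\<^sub>n|\<^sup>2 + \<parallel>X\<^sub>n\<^sub>+\<^sub>1\<parallel>\<^sup>2\<close>. This is the recursion in
  the proof of Littlewood's subordination principle, arranged so that \<open>\<alpha> = 0\<close> is not needed.
\<close>

lemma contraction_power_sum_bound:
  fixes T :: "'a::complex_hilbert_space \<Rightarrow> 'a"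
  assumes T: "bounded_clinear T" and contr: "\<And>x. norm (T x) \<le> norm x"
    and e: "norm e = 1" and eig: "\<And>x. cinner (T x) e = \<alpha> * cinner x e" and \<alpha>: "cmod \<alpha> < 1"
  shows "norm (\<Sum>n<N. f n *\<^sub>C (T ^^ n) e) \<le> L2_set (\<lambda>n. cmod (f n)) {..<N} / (1 - cmod \<alpha>)"
proof -
  \<comment> \<open>The tails are cut off at total degree \<open>N\<close>, so that
    \<open>X N = 0\<close> and \<open>y N = 0\<close> end the recursion.\<close>
  define X where "X n = (\<Sum>k<N - n. f (n + k) *\<^sub>C (T ^^ k) e)" for n
  define y where "y n = cinner (X n) e" for n
  have lin: "linear T" using T by (simp add: bounded_clinear_def bounded_linear.linear)
  have ee: "cinner e e = 1" by (simp add: cinner_self e)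
  have XS: "X n = f n *\<^sub>C e + T (X (Suc n))" if "n < N" for n
  proof -
    have *: "N - n = Suc (N - Suc n)" using that by simp
    show ?thesis
      unfolding X_def * sum.lessThan_Suc_shift
      by (simp add: linear_sum[OF lin] bounded_clinear_scaleC[OF T])
  qed
  have yS: "y n = f n + \<alpha> * y (Suc n)" if "n < N" for n
    by (simp add: y_def XS[OF that] cinner_add_left cinner_scaleC_left ee eig)
  have step: "(norm (X n))\<^sup>2 \<le> (cmod (y n))\<^sup>2 + (norm (X (Suc n)))\<^sup>2" if "n < N" for n
  proof -
    have "cinner e (T (X (Suc n))) = cnj (\<alpha> * y (Suc n))"
      using eig[of "X (Suc n)"] cinner_commute[of e "T (X (Suc n))"] by (simp add: y_def)
    then have "(norm (X n))\<^sup>2 = (cmod (f n))\<^sup>2 + (norm (T (X (Suc n))))\<^sup>2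
        + 2 * Re (f n * cnj (\<alpha> * y (Suc n)))"
      by (simp add: XS[OF that] norm_add_power2 norm_scaleC e cinner_scaleC_left)
    also have "\<dots> \<le> (cmod (f n))\<^sup>2 + (norm (X (Suc n)))\<^sup>2 + 2 * Re (f n * cnj (\<alpha> * y (Suc n)))
        + (cmod (\<alpha> * y (Suc n)))\<^sup>2"
      using power_mono[OF contr[of "X (Suc n)"] norm_ge_zero, of 2]
        zero_le_power2[of "cmod (\<alpha> * y (Suc n))"] by linarith
    also have "\<dots> = (cmod (y n))\<^sup>2 + (norm (X (Suc n)))\<^sup>2"
      unfolding yS[OF that] by (simp add: cmod_add_power2)
    finally show ?thesis .
  qed
  have "(norm (X 0))\<^sup>2 \<le> (\<Sum>k<m. (cmod (y k))\<^sup>2) + (norm (X m))\<^sup>2" if "m \<le> N" for m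
    using that
  proof (induction m)
    case (Suc m)
    then show ?case using step[of m] by simp
  qed simp
  from this[of N] have "(norm (X 0))\<^sup>2 \<le> (\<Sum>k<N. (cmod (y k))\<^sup>2)" by (simp add: X_def)
  then have X0: "norm (X 0) \<le> L2_set (\<lambda>n. cmod (y n)) {..<N}"
    unfolding L2_set_def by (rule real_le_rsqrt)
  have yN: "y N = 0" by (simp add: y_def X_def)
  \<comment> \<open>Minkowski's inequality for the recursion \<open>yS\<close>. Since
    \<open>y N = 0\<close>, the shifted sequence has norm at most \<open>?Y\<close>, and absorbing
    its term costs the factor \<open>1 / (1 - cmod \<alpha>)\<close>.\<close>
  let ?Y = "L2_set (\<lambda>n. cmod (y n)) {..<N}"
  have "?Y \<le> L2_set (\<lambda>n. cmod (f n) + cmod \<alpha> * cmod (y (Suc n))) {..<N}"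
    using norm_triangle_ineq by (intro L2_set_mono) (force simp: yS simp flip: norm_mult)+
  also have "\<dots> \<le> L2_set (\<lambda>n. cmod (f n)) {..<N} + L2_set (\<lambda>n. cmod \<alpha> * cmod (y (Suc n))) {..<N}"
    by (rule L2_set_triangle_ineq)
  also have "L2_set (\<lambda>n. cmod \<alpha> * cmod (y (Suc n))) {..<N} = cmod \<alpha> * L2_set (\<lambda>n. cmod (y (Suc n))) {..<N}"
    by (simp add: L2_set_right_distrib)
  finally have "?Y \<le> L2_set (\<lambda>n. cmod (f n)) {..<N} + cmod \<alpha> * L2_set (\<lambda>n. cmod (y (Suc n))) {..<N}" .
  moreover have "L2_set (\<lambda>n. cmod (y (Suc n))) {..<N} \<le> ?Y"
    using sum.lessThan_Suc_shift[of "\<lambda>n. (cmod (y n))\<^sup>2" N] by (simp add: L2_set_def yN)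
  then have "cmod \<alpha> * L2_set (\<lambda>n. cmod (y (Suc n))) {..<N} \<le> cmod \<alpha> * ?Y"
    by (rule mult_left_mono) simp
  ultimately have "?Y * (1 - cmod \<alpha>) \<le> L2_set (\<lambda>n. cmod (f n)) {..<N}"
    by (simp add: algebra_simps)
  then have "?Y \<le> L2_set (\<lambda>n. cmod (f n)) {..<N} / (1 - cmod \<alpha>)"
    using \<alpha> by (simp add: pos_le_divide_eq)
  then show ?thesis using X0 by (simp add: X_def)
qed


section \<open>Kernels, multipliers and weighted composition operators on the Hardy space\<close>

lemma hardy_eq_on_disk:
  assumes "\<And>z. cmod z < 1 \<Longrightarrow> h2_fun f z = h2_fun g z"
  shows "f = g"
  using assms by (intro hardy_fun_eqI) (metis dist_0_norm h2_fun_outside mem_ball)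

text \<open>The Szego kernel, fixed by its coefficients; the choice is meaningful for
  \<open>cmod w < 1\<close>, where they are square summable.\<close>

definition h2_kernel :: "complex \<Rightarrow> hardy" where
  "h2_kernel w = (SOME f. \<forall>n. h2_coeff f n = cnj w ^ n)"

lemma h2_coeff_kernel:
  assumes "cmod w < 1"
  shows "h2_coeff (h2_kernel w) n = cnj w ^ n"
proof -
  have "summable (\<lambda>n. ((cmod w)\<^sup>2) ^ n)"
    using assms by (intro summable_geometric) (auto simp: abs_square_less_1)
  then have "summable (\<lambda>n. (cmod (cnj w ^ n))\<^sup>2)"
    by (simp add: norm_power power_mult [symmetric] mult.commute)
  then obtain f where "\<And>n. h2_coeff f n = cnj w ^ n" by (rule hardy_of_coeffs) blast
  then show ?thesis
    using someI[of "\<lambda>f. \<forall>n. h2_coeff f n = cnj w ^ n" f] by (simp add: h2_kernel_def)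
qed

lemma cinner_kernel:
  assumes "cmod w < 1"
  shows "cinner f (h2_kernel w) = h2_fun f w"
  using h2_fun_sums[of w f] assms
  by (simp add: cinner_hardy_def h2_coeff_kernel sums_iff)

lemma h2_fun_kernel:
  assumes "cmod w < 1" "cmod z < 1"
  shows "h2_fun (h2_kernel w) z = 1 / (1 - cnj w * z)"
proof -
  have "cmod (cnj w * z) < 1"
    using mult_strict_mono'[of "cmod w" 1 "cmod z" 1] assms by (simp add: norm_mult)
  from geometric_sums[OF this] show ?thesis
    using h2_fun_sums[of z "h2_kernel w"] assms
    by (auto simp: h2_coeff_kernel simp flip: power_mult_distrib dest: sums_unique2)
qed

definition h2_shift :: "hardy \<Rightarrow> hardy" where
  "h2_shift f = (SOME g. \<forall>n. h2_coeff g n = (case n of 0 \<Rightarrow> 0 | Suc m \<Rightarrow> h2_coeff f m))"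

lemma h2_coeff_shift:
  "h2_coeff (h2_shift f) n = (case n of 0 \<Rightarrow> 0 | Suc m \<Rightarrow> h2_coeff f m)"
proof -
  let ?a = "\<lambda>n. case n of 0 \<Rightarrow> 0 | Suc m \<Rightarrow> h2_coeff f m"
  have "summable (\<lambda>n. (cmod (?a n))\<^sup>2)"
    using h2_coeff_summable[of f] by (subst summable_Suc_iff[symmetric]) simp
  then obtain g where "\<And>n. h2_coeff g n = ?a n" by (rule hardy_of_coeffs) blast
  then show ?thesis
    using someI[of "\<lambda>g. \<forall>n. h2_coeff g n = ?a n" g] by (simp add: h2_shift_def)
qed

lemma h2_fun_shift:
  assumes "cmod z < 1"
  shows "h2_fun (h2_shift f) z = z * h2_fun f z"
proof -
  have "(\<lambda>n. h2_coeff f n * z ^ n) sums h2_fun f z" by (rule h2_fun_sums) (simp add: assms)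
  from sums_mult[OF this, of z]
  have "(\<lambda>n. h2_coeff (h2_shift f) (Suc n) * z ^ Suc n) sums (z * h2_fun f z)"
    by (simp add: h2_coeff_shift mult_ac)
  from sums_Suc[OF this] have "(\<lambda>n. h2_coeff (h2_shift f) n * z ^ n) sums (z * h2_fun f z)"
    by (simp add: h2_coeff_shift)
  then show ?thesis
    using h2_fun_sums[of z "h2_shift f"] assms by (auto dest: sums_unique2)
qed

lemma norm_h2_shift: "norm (h2_shift f) = norm f"
proof -
  have "(\<Sum>n. (cmod (h2_coeff (h2_shift f) n))\<^sup>2) = (\<Sum>n. (cmod (h2_coeff f n))\<^sup>2)"
    using suminf_split_head[OF h2_coeff_summable[of "h2_shift f"]] by (simp add: h2_coeff_shift)
  then show ?thesis by (simp add: norm_hardy_def)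
qed

text \<open>A predicate on \<open>T\<close>, since boundedness has to be proved for each symbol.
  Multipliers have the identity as \<open>\<tau>\<close>, composition operators the constant
  \<open>u = 1\<close>.\<close>

definition weighted_op ::
  "(complex \<Rightarrow> complex) \<Rightarrow> (complex \<Rightarrow> complex) \<Rightarrow> (hardy \<Rightarrow> hardy) \<Rightarrow> bool" where
  "weighted_op u \<tau> T \<longleftrightarrow> bounded_clinear T \<and>
     (\<forall>f z. cmod z < 1 \<longrightarrow> h2_fun (T f) z = u z * h2_fun f (\<tau> z))"

lemma weighted_op_bounded: "weighted_op u \<tau> T \<Longrightarrow> bounded_clinear T"
  by (simp add: weighted_op_def)

lemma weighted_op_apply:
  "weighted_op u \<tau> T \<Longrightarrow> cmod z < 1 \<Longrightarrow> h2_fun (T f) z = u z * h2_fun f (\<tau> z)"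
  by (simp add: weighted_op_def)

text \<open>Choosing an image for each \<open>f\<close> separately suffices: elements of the Hardy
  space are determined on the disk, so linearity is inherited from the pointwise formula.\<close>

lemma weighted_op_exists:
  assumes "\<And>f. \<exists>g. norm g \<le> C * norm f \<and> (\<forall>z. cmod z < 1 \<longrightarrow> h2_fun g z = u z * h2_fun f (\<tau> z))"
  obtains T where "weighted_op u \<tau> T" "\<And>f. norm (T f) \<le> C * norm f"
proof -
  obtain T where T: "\<And>f. norm (T f) \<le> C * norm f"
    "\<And>f z. cmod z < 1 \<Longrightarrow> h2_fun (T f) z = u z * h2_fun f (\<tau> z)"
    using assms by metis
  have "bounded_clinear T"
    by (rule bounded_clinearI[where C = C])
      (auto intro!: hardy_eq_on_disk simp: T algebra_simps)
  then show ?thesis using T by (intro that) (auto simp: weighted_op_def)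
qed

text \<open>The function handed to \<open>Abs_hardy\<close> is \<open>h2_fun (T f)\<close>, hence an
  element of \<open>hardy_set\<close>, where \<open>Abs_hardy\<close> is specified.\<close>

lemma composition_op_eq:
  assumes "weighted_op (\<lambda>_. 1) \<phi> T"
  shows "composition_op \<phi> = T"
proof
  fix f
  have "(\<lambda>z. if z \<in> ball 0 1 then h2_fun f (\<phi> z) else 0) = h2_fun (T f)"
    using weighted_op_apply[OF assms, of _ f] by (auto simp: fun_eq_iff h2_fun_outside)
  then show "composition_op \<phi> f = T f"
    by (simp add: composition_op_def h2_fun_inverse)
qed

section \<open>Multiplication by linear-fractional functions\<close>

text \<open>Division of \<open>f\<close> by \<open>c z + d\<close> as a fixed-point problem: the
  shift is isometric, so \<open>F\<close> is a contraction with ratio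
  \<open>cmod (c / d)\<close>.\<close>

lemma h2_linear_division:
  assumes cd: "cmod c < cmod d"
  obtains x where "c *\<^sub>C h2_shift x + d *\<^sub>C x = f" "norm x \<le> norm f / (cmod d - cmod c)"
proof -
  have d: "d \<noteq> 0" using cd by auto
  have diff: "h2_shift x - h2_shift y = h2_shift (x - y)" for x y
    by (rule hardy_eq_on_disk) (simp add: h2_fun_shift algebra_simps)
  define F where "F x = (1 / d) *\<^sub>C (f - c *\<^sub>C h2_shift x)" for x
  have "\<exists>!x. F x = x"
  proof (rule banach_fix_type)
    show "0 \<le> cmod (c / d)" "cmod (c / d) < 1" using cd d by (auto simp: norm_divide)
    have "F x - F y = (- c / d) *\<^sub>C h2_shift (x - y)" for x y
      unfolding diff[symmetric] by (rule hardy_fun_eqI) (simp add: F_def algebra_simps)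
    then show "\<forall>x y. dist (F x) (F y) \<le> cmod (c / d) * dist x y"
      by (simp add: dist_norm norm_scaleC norm_h2_shift norm_divide)
  qed
  then obtain x where x: "F x = x" by blast
  have eq: "c *\<^sub>C h2_shift x + d *\<^sub>C x = f"
    by (subst (2) x[symmetric], rule hardy_fun_eqI) (simp add: F_def d)
  have "d *\<^sub>C x = f - c *\<^sub>C h2_shift x" using eq by (simp add: algebra_simps)
  then have "norm (d *\<^sub>C x) \<le> norm f + norm (c *\<^sub>C h2_shift x)"
    by (simp add: norm_triangle_ineq4)
  then have "norm x * (cmod d - cmod c) \<le> norm f"
    by (simp add: norm_scaleC norm_h2_shift algebra_simps)
  then have "norm x \<le> norm f / (cmod d - cmod c)"
    using cd by (simp add: pos_le_divide_eq)
  with eq show ?thesis by (rule that)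
qed

lemma denominator_nonzero:
  assumes "cmod c < cmod d" "cmod z \<le> 1"
  shows "c * z + d \<noteq> 0"
proof
  assume "c * z + d = 0"
  then have "cmod d = cmod c * cmod z" by (metis add_eq_0_iff norm_minus_cancel norm_mult)
  also have "\<dots> \<le> cmod c" using assms mult_left_mono[of "cmod z" 1 "cmod c"] by simp
  finally show False using assms by simp
qed

lemma linfrac_multiplier_eq:
  assumes cd: "cmod c < cmod d" and x: "c *\<^sub>C h2_shift x + d *\<^sub>C x = f" and z: "cmod z < 1"
  shows "h2_fun (a *\<^sub>C h2_shift x + b *\<^sub>C x) z = (a * z + b) / (c * z + d) * h2_fun f z"
proof -
  have "c * z + d \<noteq> 0" using denominator_nonzero[OF cd, of z] z by simp
  then show ?thesis unfolding x[symmetric] by (simp add: h2_fun_shift z field_simps)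
qed

lemma linfrac_multiplier:
  assumes cd: "cmod c < cmod d"
  obtains T where "weighted_op (\<lambda>z. (a * z + b) / (c * z + d)) (\<lambda>z. z) T"
proof (rule weighted_op_exists[where C = "(cmod a + cmod b) / (cmod d - cmod c)"])
  fix f
  obtain x where x: "c *\<^sub>C h2_shift x + d *\<^sub>C x = f" "norm x \<le> norm f / (cmod d - cmod c)"
    by (rule h2_linear_division[OF cd])
  let ?g = "a *\<^sub>C h2_shift x + b *\<^sub>C x"
  have "norm ?g \<le> norm (a *\<^sub>C h2_shift x) + norm (b *\<^sub>C x)" by (rule norm_triangle_ineq)
  also have "\<dots> = (cmod a + cmod b) * norm x"
    by (simp add: norm_scaleC norm_h2_shift algebra_simps)
  also have "\<dots> \<le> (cmod a + cmod b) * (norm f / (cmod d - cmod c))"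
    by (intro mult_left_mono x) auto
  finally show "\<exists>g. norm g \<le> (cmod a + cmod b) / (cmod d - cmod c) * norm f \<and>
      (\<forall>z. cmod z < 1 \<longrightarrow> h2_fun g z = (a * z + b) / (c * z + d) * h2_fun f z)"
    using linfrac_multiplier_eq[OF cd x(1)] by (intro exI[of _ ?g]) auto
qed (rule that)

text \<open>
  On the circle \<open>|c z + d|\<^sup>2 - |a z + b|\<^sup>2 = E + 2 Re (\<kappa> z)\<close>, and the same formula holds for
  the operators because the shift is isometric.
\<close>

lemma linfrac_shift_le:
  assumes "\<And>z. cmod z = 1 \<Longrightarrow> cmod (a * z + b) \<le> cmod (c * z + d)"
  shows "norm (a *\<^sub>C h2_shift x + b *\<^sub>C x) \<le> norm (c *\<^sub>C h2_shift x + d *\<^sub>C x)"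
proof -
  define E where "E = (cmod c)\<^sup>2 + (cmod d)\<^sup>2 - (cmod a)\<^sup>2 - (cmod b)\<^sup>2"
  define \<kappa> where "\<kappa> = c * cnj d - a * cnj b"
  define s where "s = cinner (h2_shift x) x"
  have nonneg: "0 \<le> E + 2 * Re (\<kappa> * z)" if "cmod z = 1" for z
  proof -
    have *: "(cmod (p * z + q))\<^sup>2 = (cmod p)\<^sup>2 + (cmod q)\<^sup>2 + 2 * Re (p * cnj q * z)" for p q
    proof -
      have "(cmod (p * z + q))\<^sup>2 = (cmod (p * z))\<^sup>2 + (cmod q)\<^sup>2 + 2 * Re (p * cnj q * z)"
        by (simp add: cmod_add_power2 mult_ac)
      then show ?thesis using that by (simp add: norm_mult)
    qed
    have "(cmod (a * z + b))\<^sup>2 \<le> (cmod (c * z + d))\<^sup>2"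
      by (intro power_mono assms that) auto
    then show ?thesis unfolding * by (simp add: E_def \<kappa>_def algebra_simps)
  qed
  have E: "2 * cmod \<kappa> \<le> E"
  proof (cases "\<kappa> = 0")
    case True
    then show ?thesis using nonneg[of 1] by simp
  next
    \<comment> \<open>The real part of \<open>\<kappa> * z\<close> on the circle is smallest at
      \<open>z = - cnj (sgn \<kappa>)\<close>.\<close>
    case False
    then have "\<kappa> * (- cnj (sgn \<kappa>)) = - complex_of_real (cmod \<kappa>)"
      using complex_norm_square[of \<kappa>] by (simp add: sgn_eq field_simps power2_eq_square)
    then show ?thesis using nonneg[of "- cnj (sgn \<kappa>)"] False by (simp add: norm_sgn)
  qed
  have norm2: "(norm (p *\<^sub>C h2_shift x + q *\<^sub>C x))\<^sup>2
      = ((cmod p)\<^sup>2 + (cmod q)\<^sup>2) * (norm x)\<^sup>2 + 2 * Re (p * cnj q * s)" for p q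
    unfolding norm_add_power2
    by (simp add: norm_scaleC norm_h2_shift cinner_scaleC_left cinner_scaleC_right
        s_def algebra_simps power_mult_distrib)
  \<comment> \<open>In \<open>norm2\<close> the number \<open>s\<close> stands where
    \<open>(norm x)\<^sup>2 * z\<close> would; Cauchy-Schwarz replaces
    \<open>cmod z = 1\<close>.\<close>
  have "cmod s \<le> (norm x)\<^sup>2"
    using cmod_cinner_le[of "h2_shift x" x] by (simp add: s_def norm_h2_shift power2_eq_square)
  then have "2 * cmod \<kappa> * cmod s \<le> E * (norm x)\<^sup>2"
    using E by (intro mult_mono) (auto intro: order_trans[of _ "2 * cmod \<kappa>"])
  moreover have "- (cmod \<kappa> * cmod s) \<le> Re (\<kappa> * s)"
    using abs_Re_le_cmod[of "\<kappa> * s"] by (simp add: norm_mult)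
  ultimately have "0 \<le> E * (norm x)\<^sup>2 + 2 * Re (\<kappa> * s)" by linarith
  then have "(norm (a *\<^sub>C h2_shift x + b *\<^sub>C x))\<^sup>2 \<le> (norm (c *\<^sub>C h2_shift x + d *\<^sub>C x))\<^sup>2"
    unfolding norm2 by (simp add: E_def \<kappa>_def algebra_simps)
  then show ?thesis by (rule power2_le_imp_le) simp
qed

text \<open>Writing \<open>f = (c z + d) x\<close> makes the product \<open>(a z + b) x\<close>, so
  \<open>linfrac_shift_le\<close> compares exactly the two norms in question.\<close>

lemma linfrac_multiplier_contraction:
  assumes cd: "cmod c < cmod d"
    and le: "\<And>z. cmod z = 1 \<Longrightarrow> cmod (a * z + b) \<le> cmod (c * z + d)"
  obtains T where "weighted_op (\<lambda>z. (a * z + b) / (c * z + d)) (\<lambda>z. z) T" "\<And>f. norm (T f) \<le> norm f"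
proof (rule weighted_op_exists[where C = 1])
  fix f
  obtain x where x: "c *\<^sub>C h2_shift x + d *\<^sub>C x = f"
    by (rule h2_linear_division[OF cd])
  let ?g = "a *\<^sub>C h2_shift x + b *\<^sub>C x"
  have "norm ?g \<le> norm f" using linfrac_shift_le[OF le, of x] by (simp add: x)
  then show "\<exists>g. norm g \<le> 1 * norm f \<and>
      (\<forall>z. cmod z < 1 \<longrightarrow> h2_fun g z = (a * z + b) / (c * z + d) * h2_fun f z)"
    using linfrac_multiplier_eq[OF cd x] by (intro exI[of _ ?g]) auto
qed (use that in auto)

section \<open>Composition operators by subordination\<close>

lemma h2_fun_sum: "h2_fun (\<Sum>n\<in>I. g n) z = (\<Sum>n\<in>I. h2_fun (g n) z)"
  by (induction I rule: infinite_finite_induct) auto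

lemma tendsto_h2_fun:
  assumes X: "X \<longlonglongrightarrow> g" and z: "cmod z < 1"
  shows "(\<lambda>n. h2_fun (X n) z) \<longlonglongrightarrow> h2_fun g z"
proof (rule Lim_transform2[OF tendsto_const])
  show "(\<lambda>n. h2_fun g z - h2_fun (X n) z) \<longlonglongrightarrow> 0"
  proof (rule Lim_null_comparison)
    show "\<forall>\<^sub>F n in sequentially. norm (h2_fun g z - h2_fun (X n) z) \<le> norm (g - X n) * norm (h2_kernel z)"
      using cmod_cinner_le[of "g - X _" "h2_kernel z"]
      by (auto simp: cinner_kernel[OF z])
    have "(\<lambda>n. norm (g - X n) * norm (h2_kernel z)) \<longlonglongrightarrow> norm (g - g) * norm (h2_kernel z)"
      by (intro tendsto_intros X)
    then show "(\<lambda>n. norm (g - X n) * norm (h2_kernel z)) \<longlonglongrightarrow> 0" by simp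
  qed
qed

text \<open>The powers of \<open>M\<close> applied to the constant function 1 are the powers of
  \<open>\<phi>\<close>, so the partial sums of \<open>f \<circ> \<phi>\<close> are controlled by
  \<open>contraction_power_sum_bound\<close>. Pairing with 1 is evaluation at 0, which gives the
  eigenvalue \<open>\<phi> 0\<close>.\<close>

lemma composition_of_contractive_multiplier:
  assumes M: "weighted_op \<phi> (\<lambda>z. z) M" and contr: "\<And>f. norm (M f) \<le> norm f"
    and \<phi>: "\<And>z. cmod z < 1 \<Longrightarrow> cmod (\<phi> z) < 1"
  obtains T where "weighted_op (\<lambda>_. 1) \<phi> T"
proof -
  define e where "e = h2_kernel 0"
  have e_fun: "h2_fun e z = 1" if "cmod z < 1" for z
    using that by (simp add: e_def h2_fun_kernel)
  have cinner_e: "cinner f e = h2_fun f 0" for f by (simp add: e_def cinner_kernel)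
  have "complex_of_real ((norm e)\<^sup>2) = 1" by (simp add: cinner_e e_fun flip: cinner_self del: of_real_power)
  then have "(norm e)\<^sup>2 = 1" by (simp only: of_real_eq_1_iff)
  then have ne: "norm e = 1" by (simp add: power2_eq_1_iff) (metis norm_ge_zero not_one_le_zero neg_0_le_iff_le)
  have pow: "h2_fun ((M ^^ n) e) z = \<phi> z ^ n" if "cmod z < 1" for n z
    by (induction n) (simp_all add: e_fun weighted_op_apply[OF M] that)
  have \<phi>0: "cmod (\<phi> 0) < 1" by (simp add: \<phi>)
  define C where "C = 1 / (1 - cmod (\<phi> 0))"
  have C: "C > 0" using \<phi>0 by (simp add: C_def)
  have bound: "norm (\<Sum>n<N. a n *\<^sub>C (M ^^ n) e) \<le> C * L2_set (\<lambda>n. cmod (a n)) {..<N}" for a N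
    using contraction_power_sum_bound[OF weighted_op_bounded[OF M] contr ne _ \<phi>0, of a N]
    by (simp add: C_def cinner_e weighted_op_apply[OF M])
  have "\<exists>g. norm g \<le> C * norm f \<and> (\<forall>z. cmod z < 1 \<longrightarrow> h2_fun g z = 1 * h2_fun f (\<phi> z))" for f
  proof -
    define X where "X N = (\<Sum>n<N. h2_coeff f n *\<^sub>C (M ^^ n) e)" for N
    have diff: "norm (X N - X m) \<le> C * sqrt (\<Sum>n=m..<N. (cmod (h2_coeff f n))\<^sup>2)" if "m \<le> N" for m N
    proof -
      \<comment> \<open>Zeroing the first \<open>m\<close> coefficients lets the bound for full sums
        measure only the block from \<open>m\<close> to \<open>N\<close>.\<close>
      let ?a = "\<lambda>n. if n < m then 0 else h2_coeff f n"
      have split: "{..<N} = {..<m} \<union> {m..<N}" "{..<m} \<inter> {m..<N} = {}" using that by auto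
      have "X N - X m = (\<Sum>n<N. ?a n *\<^sub>C (M ^^ n) e)"
        unfolding X_def split(1) by (subst (1 2) sum.union_disjoint) auto
      then have "norm (X N - X m) \<le> C * L2_set (\<lambda>n. cmod (?a n)) {..<N}"
        using bound[of ?a N] by simp
      also have "L2_set (\<lambda>n. cmod (?a n)) {..<N} = sqrt (\<Sum>n=m..<N. (cmod (h2_coeff f n))\<^sup>2)"
        unfolding L2_set_def split(1) by (subst sum.union_disjoint) auto
      finally show ?thesis .
    qed
    have "Cauchy X"
    proof (rule CauchyI')
      fix r :: real assume "r > 0"
      then have "(r / C)\<^sup>2 > 0" using C by simp
      then obtain K where K: "\<And>m N. m \<ge> K \<Longrightarrow>
          norm (\<Sum>n=m..<N. (cmod (h2_coeff f n))\<^sup>2) < (r / C)\<^sup>2"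
        using h2_coeff_summable[of f] unfolding summable_Cauchy by blast
      have "norm (X m - X N) < r" if "m \<ge> K" "m < N" for m N
      proof -
        have "norm (X N - X m) \<le> C * sqrt (\<Sum>n=m..<N. (cmod (h2_coeff f n))\<^sup>2)"
          using that by (intro diff) simp
        also have "sqrt (\<Sum>n=m..<N. (cmod (h2_coeff f n))\<^sup>2) < r / C"
          using K[OF that(1), of N] C \<open>r > 0\<close> by (intro real_less_lsqrt) (auto simp: sum_nonneg)
        finally show ?thesis using C by (simp add: norm_minus_commute)
      qed
      then show "\<exists>K. \<forall>m\<ge>K. \<forall>N>m. dist (X m) (X N) < r" by (auto simp: dist_norm)
    qed
    then obtain g where g: "X \<longlonglongrightarrow> g" using Cauchy_convergent convergent_def by blast
    have "norm (X N) \<le> C * norm f" for N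
    proof -
      have "norm (X N) \<le> C * L2_set (\<lambda>n. cmod (h2_coeff f n)) {..<N}"
        unfolding X_def by (rule bound)
      also have "L2_set (\<lambda>n. cmod (h2_coeff f n)) {..<N} \<le> norm f"
        unfolding L2_set_def by (rule real_le_lsqrt) (auto simp: hardy_partial_sum_le sum_nonneg)
      finally show ?thesis using C by simp
    qed
    then have "norm g \<le> C * norm f"
      by (intro tendsto_upperbound[OF tendsto_norm[OF g]]) auto
    moreover have "h2_fun g z = h2_fun f (\<phi> z)" if z: "cmod z < 1" for z
    proof (rule LIMSEQ_unique[OF tendsto_h2_fun[OF g z]])
      show "(\<lambda>N. h2_fun (X N) z) \<longlonglongrightarrow> h2_fun f (\<phi> z)"
        using h2_fun_sums[of "\<phi> z" f] \<phi>[OF z]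
        by (simp add: X_def h2_fun_sum pow[OF z] sums_def)
    qed
    ultimately show ?thesis by auto
  qed
  from weighted_op_exists[of C "\<lambda>_. 1" \<phi>, OF this] show ?thesis using that by blast
qed


section \<open>Linear-fractional selfmaps of the disk\<close>

text \<open>In this form, free of division, the inequality also says that the denominator has no
  zero in the disk.\<close>

definition disk_map :: "complex \<Rightarrow> complex \<Rightarrow> complex \<Rightarrow> complex \<Rightarrow> bool" where
  "disk_map a b c d \<longleftrightarrow> (\<forall>z. cmod z < 1 \<longrightarrow> cmod (a * z + b) < cmod (c * z + d))"

text \<open>Continuity extends the inequality to the closed disk. A zero of the denominator there
  would be a zero of the numerator as well, which the determinant excludes.\<close>

lemma linfrac_le_cball:
  assumes det: "a * d - b * c \<noteq> 0"
    and le: "\<And>z. cmod z < 1 \<Longrightarrow> cmod (a * z + b) \<le> cmod (c * z + d)" and z: "cmod z \<le> 1"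
  shows "c * z + d \<noteq> 0" "cmod (a * z + b) \<le> cmod (c * z + d)"
proof -
  have "cmod (a * z + b) - cmod (c * z + d) \<le> 0"
  proof (rule continuous_le_on_closure[where S = "ball 0 1" and x = z and a = 0])
    show "continuous_on (closure (ball 0 1)) (\<lambda>z. cmod (a * z + b) - cmod (c * z + d))"
      by (intro continuous_intros)
  qed (use z le in auto)
  then show *: "cmod (a * z + b) \<le> cmod (c * z + d)" by simp
  show "c * z + d \<noteq> 0"
  proof
    assume "c * z + d = 0"
    with * have "d = - c * z" "b = - a * z" by (auto simp: add_eq_0_iff)
    then show False using det by simp
  qed
qed

text \<open>Otherwise the pole \<open>- d / c\<close> would lie in the closed disk.\<close>

lemma linfrac_denominator_less:
  assumes det: "a * d - b * c \<noteq> 0"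
    and le: "\<And>z. cmod z < 1 \<Longrightarrow> cmod (a * z + b) \<le> cmod (c * z + d)"
  shows "cmod c < cmod d"
proof (rule ccontr)
  assume *: "\<not> ?thesis"
  have "c \<noteq> 0" using * linfrac_le_cball(1)[OF det le, of 0] by auto
  moreover from this * have "cmod (- d / c) \<le> 1" by (simp add: norm_divide)
  ultimately show False using linfrac_le_cball(1)[OF det le, of "- d / c"] by simp
qed

lemma open_linfrac_image:
  assumes det: "a * d - b * c \<noteq> 0" and nz: "\<And>z. cmod z < 1 \<Longrightarrow> c * z + d \<noteq> 0"
  shows "open ((\<lambda>z. (a * z + b) / (c * z + d)) ` ball 0 1)"
proof (rule open_mapping_thm3)
  show "(\<lambda>z. (a * z + b) / (c * z + d)) holomorphic_on ball 0 1"
    using nz by (intro holomorphic_intros) auto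
  show "inj_on (\<lambda>z. (a * z + b) / (c * z + d)) (ball 0 1)"
  proof (rule inj_onI)
    fix z w
    assume "z \<in> ball 0 1" "w \<in> ball 0 1" and eq: "(a * z + b) / (c * z + d) = (a * w + b) / (c * w + d)"
    then have "c * z + d \<noteq> 0" "c * w + d \<noteq> 0" using nz by auto
    with eq have "(a * d - b * c) * (z - w) = 0" by (simp add: frac_eq_eq) algebra
    then show "z = w" using det by simp
  qed
qed auto

text \<open>The image of the disk is open by the open mapping theorem, and an open subset of the
  closed disk lies in its interior.\<close>

lemma disk_mapI_le:
  assumes det: "a * d - b * c \<noteq> 0"
    and le: "\<And>z. cmod z < 1 \<Longrightarrow> cmod (a * z + b) \<le> cmod (c * z + d)"
  shows "disk_map a b c d"
  unfolding disk_map_def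
proof (intro allI impI)
  fix z assume z: "cmod z < 1"
  let ?F = "\<lambda>z. (a * z + b) / (c * z + d)"
  have nz: "c * z + d \<noteq> 0" if "cmod z < 1" for z
    using linfrac_le_cball(1)[OF det le, of z] that by simp
  have "?F ` ball 0 1 \<subseteq> cball 0 1"
    using le nz by (auto simp: norm_divide)
  then have "?F ` ball 0 1 \<subseteq> interior (cball 0 1)"
    by (rule interior_maximal) (rule open_linfrac_image[OF det nz])
  moreover have "?F z \<in> ?F ` ball 0 1" using z by (intro imageI) auto
  ultimately have "cmod (?F z) < 1" by (auto simp: interior_cball)
  then show "cmod (a * z + b) < cmod (c * z + d)"
    using nz[OF z] by (simp add: norm_divide)
qed

lemma disk_map_le: "disk_map a b c d \<Longrightarrow> cmod z < 1 \<Longrightarrow> cmod (a * z + b) \<le> cmod (c * z + d)"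
  by (auto simp: disk_map_def intro: less_imp_le)

text \<open>
  For \<open>|t| < 1\<close> the kernel denominator \<open>(c w + d) - t (a w + b) = (d - t b) - (t a - c) w\<close> has no
  zero in the closed disk.
\<close>

lemma disk_map_adjoint:
  assumes det: "a * d - b * c \<noteq> 0" and map: "disk_map a b c d"
  shows "disk_map (cnj a) (- cnj c) (- cnj b) (cnj d)"
  unfolding disk_map_def
proof (intro allI impI)
  fix z assume z: "cmod z < 1"
  define t where "t = cnj z"
  have t: "cmod t < 1" using z by (simp add: t_def)
  have nz: "(d - t * b) - (t * a - c) * w \<noteq> 0" if "cmod w \<le> 1" for w
  proof
    assume "(d - t * b) - (t * a - c) * w = 0"
    then have "c * w + d = t * (a * w + b)" by algebra
    then have "cmod (c * w + d) = cmod t * cmod (a * w + b)" by (simp add: norm_mult)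
    also have "\<dots> \<le> cmod t * cmod (c * w + d)"
      using linfrac_le_cball(2)[OF det disk_map_le[OF map] that] by (intro mult_left_mono) auto
    also have "\<dots> < 1 * cmod (c * w + d)"
      using linfrac_le_cball(1)[OF det disk_map_le[OF map] that] t by (intro mult_strict_right_mono) auto
    finally show False by simp
  qed
  \<comment> \<open>Otherwise the polynomial in \<open>nz\<close> would have a zero in the closed
    disk.\<close>
  have "cmod (t * a - c) < cmod (d - t * b)"
  proof (rule ccontr)
    assume *: "\<not> ?thesis"
    have "t * a - c \<noteq> 0" using * nz[of 0] by auto
    moreover from this * have "cmod ((d - t * b) / (t * a - c)) \<le> 1" by (simp add: norm_divide)
    ultimately show False using nz[of "(d - t * b) / (t * a - c)"] by simp
  qed
  moreover have "cnj a * z + - cnj c = cnj (t * a - c)" "- cnj b * z + cnj d = cnj (d - t * b)"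
    by (simp_all add: t_def)
  ultimately show "cmod (cnj a * z + - cnj c) < cmod (- cnj b * z + cnj d)"
    by (simp only: complex_mod_cnj)
qed

section \<open>The extended plane in homogeneous coordinates\<close>

text \<open>\<open>ehom x y\<close> is the point of the extended plane with homogeneous coordinates \<open>[x : y]\<close>.\<close>

definition ehom :: "complex \<Rightarrow> complex \<Rightarrow> ecomplex" where
  "ehom x y = (if y = 0 then Infty else Fin (x / y))"

lemma Fin_eq_ehom: "Fin z = ehom z 1"
  by (simp add: ehom_def)

lemma ehom_cases:
  obtains x y where "u = ehom x y" "x \<noteq> 0 \<or> y \<noteq> 0"
proof (cases u)
  case (Fin z)
  then show ?thesis using that[of z 1] by (simp add: ehom_def)
next
  case Infty
  then show ?thesis using that[of 1 0] by (simp add: ehom_def)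
qed

lemma ehom_scale: "k \<noteq> 0 \<Longrightarrow> ehom (k * x) (k * y) = ehom x y"
  by (simp add: ehom_def)

lemma einverse_ecnj_ehom:
  "x \<noteq> 0 \<or> y \<noteq> 0 \<Longrightarrow> einverse (ecnj (ehom x y)) = ehom (cnj y) (cnj x)"
  by (auto simp: ehom_def)

lemma ehom_in_edisk: "x \<noteq> 0 \<or> y \<noteq> 0 \<Longrightarrow> ehom x y \<in> edisk \<longleftrightarrow> cmod x < cmod y"
  by (auto simp: ehom_def edisk_def norm_divide)

lemma lft_ehom_nonzero:
  fixes a b c d x y :: complex
  assumes "a * d - b * c \<noteq> 0" "x \<noteq> 0 \<or> y \<noteq> 0"
  shows "a * x + b * y \<noteq> 0 \<or> c * x + d * y \<noteq> 0"
proof (rule ccontr)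
  assume "\<not> ?thesis"
  then have "(a * d - b * c) * x = 0" "(a * d - b * c) * y = 0" by algebra+
  then show False using assms by simp
qed

lemma lft_ehom:
  assumes "a * d - b * c \<noteq> 0" "x \<noteq> 0 \<or> y \<noteq> 0"
  shows "lft a b c d (ehom x y) = ehom (a * x + b * y) (c * x + d * y)"
proof (cases "y = 0")
  case True
  then show ?thesis using assms by (simp add: ehom_def)
next
  case False
  then have "c * (x / y) + d = (c * x + d * y) / y" "a * (x / y) + b = (a * x + b * y) / y"
    by (simp_all add: field_simps)
  then show ?thesis using False by (simp add: ehom_def)
qed

lemma lft_ehom_in_edisk:
  assumes "a * d - b * c \<noteq> 0" "x \<noteq> 0 \<or> y \<noteq> 0"
  shows "lft a b c d (ehom x y) \<in> edisk \<longleftrightarrow> cmod (a * x + b * y) < cmod (c * x + d * y)"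
  by (simp only: lft_ehom[OF assms] ehom_in_edisk[OF lft_ehom_nonzero[OF assms]])

text \<open>The coefficients of the inverse form the adjugate matrix; the product of the two
  matrices is the determinant times the identity, and a common factor does not move a point.\<close>

lemma lft_lft_inverse:
  assumes det: "a * d - b * c \<noteq> 0"
  shows "lft d (- b) (- c) a (lft a b c d u) = u"
proof -
  obtain x y where u: "u = ehom x y" "x \<noteq> 0 \<or> y \<noteq> 0" by (rule ehom_cases)
  have det': "d * a - (- b) * (- c) \<noteq> 0" using det by (simp add: mult.commute)
  have "lft d (- b) (- c) a (lft a b c d u) = ehom ((a * d - b * c) * x) ((a * d - b * c) * y)"
    unfolding u(1) lft_ehom[OF det u(2)] lft_ehom[OF det' lft_ehom_nonzero[OF det u(2)]]
    by (simp add: algebra_simps)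
  then show ?thesis by (simp only: ehom_scale[OF det] u)
qed

lemma inv_lft:
  assumes det: "a * d - b * c \<noteq> 0"
  shows "inv (lft a b c d) = lft d (- b) (- c) a"
proof (rule inv_equality)
  have "d * a - (- b) * (- c) \<noteq> 0" using det by (simp add: mult.commute)
  from lft_lft_inverse[OF this] show "lft a b c d (lft d (- b) (- c) a u) = u" for u by simp
qed (rule lft_lft_inverse[OF det])

lemma lft_image_edisk_subset:
  assumes "a * d - b * c \<noteq> 0"
  shows "lft a b c d ` edisk \<subseteq> edisk \<longleftrightarrow> disk_map a b c d"
proof -
  have "lft a b c d (Fin z) \<in> edisk \<longleftrightarrow> cmod (a * z + b) < cmod (c * z + d)" for z
    using lft_ehom_in_edisk[OF assms, of z 1] by (simp add: Fin_eq_ehom)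
  then show ?thesis by (auto simp: edisk_def disk_map_def image_subset_iff)
qed

lemma lft_comp_inv:
  fixes a b c d :: complex
  assumes det: "a * d - b * c \<noteq> 0" and det': "a' * d' - b' * c' \<noteq> 0"
  shows "lft a' b' c' d' \<circ> inv (lft a b c d) =
    lft (a' * d - b' * c) (b' * a - a' * b) (c' * d - d' * c) (d' * a - c' * b)"
proof
  fix u
  obtain x y where u: "u = ehom x y" "x \<noteq> 0 \<or> y \<noteq> 0" by (rule ehom_cases)
  have detinv: "d * a - (- b) * (- c) \<noteq> 0" using det by (simp add: mult.commute)
  have "(a' * d - b' * c) * (d' * a - c' * b) - (b' * a - a' * b) * (c' * d - d' * c)
      = (a * d - b * c) * (a' * d' - b' * c')" by algebra
  then have detcomp:
    "(a' * d - b' * c) * (d' * a - c' * b) - (b' * a - a' * b) * (c' * d - d' * c) \<noteq> 0"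
    using det det' by simp
  show "(lft a' b' c' d' \<circ> inv (lft a b c d)) u =
    lft (a' * d - b' * c) (b' * a - a' * b) (c' * d - d' * c) (d' * a - c' * b) u"
    unfolding inv_lft[OF det] comp_apply u(1) lft_ehom[OF detinv u(2)]
      lft_ehom[OF det' lft_ehom_nonzero[OF detinv u(2)]] lft_ehom[OF detcomp u(2)]
    by (simp add: algebra_simps)
qed

text \<open>For \<open>u = [a z + b : c z + d]\<close> the reflected point is
  \<open>[cnj (c z + d) : cnj (a z + b)]\<close>, which covers infinity too. The right side denies
  that the map sends it into the disk.\<close>

lemma reflection_disjoint_iff:
  fixes a b c d :: complex
  assumes det: "a * d - b * c \<noteq> 0"
  shows "{einverse (ecnj u) | u. u \<in> lft a b c d ` edisk} \<inter> inv (lft a b c d) ` edisk = {} \<longleftrightarrow>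
    (\<forall>z. cmod z < 1 \<longrightarrow>
      cmod (c * cnj (c * z + d) + d * cnj (a * z + b)) \<le> cmod (a * cnj (c * z + d) + b * cnj (a * z + b)))"
proof -
  let ?\<phi> = "lft a b c d"
  have inv: "v \<in> inv ?\<phi> ` edisk \<longleftrightarrow> ?\<phi> v \<in> edisk" for v
  proof -
    have "d * a - (- b) * (- c) \<noteq> 0" using det by (simp add: mult.commute)
    from lft_lft_inverse[OF this] have "?\<phi> (inv ?\<phi> u) = u" for u
      by (simp add: inv_lft[OF det])
    moreover have "inv ?\<phi> (?\<phi> u) = u" for u
      by (simp add: inv_lft[OF det] lft_lft_inverse[OF det])
    ultimately show ?thesis by (metis image_iff)
  qed
  have "?\<phi> (einverse (ecnj (?\<phi> (Fin z)))) \<in> edisk \<longleftrightarrow>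
      cmod (a * cnj (c * z + d) + b * cnj (a * z + b)) < cmod (c * cnj (c * z + d) + d * cnj (a * z + b))" for z
  proof -
    have nz: "a * z + b * 1 \<noteq> 0 \<or> c * z + d * 1 \<noteq> 0" by (rule lft_ehom_nonzero[OF det]) simp
    have "einverse (ecnj (?\<phi> (Fin z))) = ehom (cnj (c * z + d)) (cnj (a * z + b))"
      using lft_ehom[OF det, of z 1] einverse_ecnj_ehom[OF nz] by (simp add: Fin_eq_ehom)
    moreover have "cnj (c * z + d) \<noteq> 0 \<or> cnj (a * z + b) \<noteq> 0"
      using nz by (simp only: complex_cnj_zero_iff mult_1_right) blast
    ultimately show ?thesis by (simp only: lft_ehom_in_edisk[OF det])
  qed
  moreover have "{einverse (ecnj u) | u. u \<in> ?\<phi> ` edisk} \<inter> inv ?\<phi> ` edisk = {} \<longleftrightarrow>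
      (\<forall>u\<in>edisk. ?\<phi> (einverse (ecnj (?\<phi> u))) \<notin> edisk)"
    unfolding disjoint_iff inv by blast
  moreover have "(\<forall>u\<in>edisk. P u) \<longleftrightarrow> (\<forall>z. cmod z < 1 \<longrightarrow> P (Fin z))" for P
    by (auto simp: edisk_def)
  ultimately show ?thesis by (simp only: not_less)
qed

text \<open>
  After conjugation the condition of \<open>reflection_disjoint_iff\<close> says that the adjoint of \<open>\<sigma> \<circ> \<phi>\<inverse>\<close>
  maps the disk into its closure.
\<close>

lemma reflection_disjoint_iff_disk_map:
  fixes a b c d :: complex
  assumes det: "a * d - b * c \<noteq> 0"
  shows "{einverse (ecnj u) | u. u \<in> lft a b c d ` edisk} \<inter> inv (lft a b c d) ` edisk = {} \<longleftrightarrow>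
    disk_map (cnj a * d + cnj c * c) (- (cnj a * b + cnj c * a))
      (- (cnj b * d + cnj d * c)) (cnj b * b + cnj d * a)"
    (is "_ \<longleftrightarrow> disk_map ?p ?q ?r ?s")
proof -
  have cnj: "cnj ?p = a * cnj d + c * cnj c" "- cnj ?r = b * cnj d + d * cnj c"
    "- cnj ?q = a * cnj b + c * cnj a" "cnj ?s = b * cnj b + d * cnj a"
    by simp_all
  have "?p * ?s - ?q * ?r = (a * d - b * c) * (cnj a * cnj d - cnj b * cnj c)" by algebra
  moreover have "cnj a * cnj d - cnj b * cnj c = cnj (a * d - b * c)" by simp
  ultimately have det1: "?p * ?s - ?q * ?r \<noteq> 0" using det by (metis complex_cnj_zero_iff mult_eq_0_iff)
  have "cnj ?p * cnj ?s - (- cnj ?r) * (- cnj ?q) = cnj (?p * ?s - ?q * ?r)"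
    unfolding complex_cnj_diff complex_cnj_mult by simp algebra
  then have det2: "cnj ?p * cnj ?s - (- cnj ?r) * (- cnj ?q) \<noteq> 0"
    using det1 by (metis complex_cnj_zero_iff)
  have num: "cmod (c * cnj (c * z + d) + d * cnj (a * z + b)) = cmod (cnj ?p * z + - cnj ?r)" for z
  proof -
    have "cnj (c * cnj (c * z + d) + d * cnj (a * z + b)) = cnj ?p * z + - cnj ?r"
      unfolding cnj by (simp add: algebra_simps)
    then show ?thesis by (metis complex_mod_cnj)
  qed
  have den: "cmod (a * cnj (c * z + d) + b * cnj (a * z + b)) = cmod (- cnj ?q * z + cnj ?s)" for z
  proof -
    have "cnj (a * cnj (c * z + d) + b * cnj (a * z + b)) = - cnj ?q * z + cnj ?s"
      unfolding cnj by (simp add: algebra_simps)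
    then show ?thesis by (metis complex_mod_cnj)
  qed
  \<comment> \<open>Taking the adjoint twice restores the coefficients, so
    \<open>disk_map_adjoint\<close> for both matrices gives an equivalence.\<close>
  have "disk_map ?p ?q ?r ?s \<longleftrightarrow> disk_map (cnj ?p) (- cnj ?r) (- cnj ?q) (cnj ?s)"
    using disk_map_adjoint[OF det1] disk_map_adjoint[OF det2]
    by (auto simp only: complex_cnj_cnj complex_cnj_minus minus_minus)
  also have "\<dots> \<longleftrightarrow> (\<forall>z. cmod z < 1 \<longrightarrow> cmod (cnj ?p * z + - cnj ?r) \<le> cmod (- cnj ?q * z + cnj ?s))"
    using disk_mapI_le[OF det2] disk_map_le by blast
  finally show ?thesis unfolding reflection_disjoint_iff[OF det] num den by blast
qed


section \<open>Composition operators with linear-fractional symbol\<close>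

text \<open>The symbol is bounded by 1 on the circle, so multiplication by it is a contraction and
  the subordination argument applies.\<close>

lemma linfrac_composition:
  assumes det: "a * d - b * c \<noteq> 0" and map: "disk_map a b c d"
  obtains T where "weighted_op (\<lambda>_. 1) (\<lambda>z. (a * z + b) / (c * z + d)) T"
proof -
  note le = disk_map_le[OF map]
  obtain M where M: "weighted_op (\<lambda>z. (a * z + b) / (c * z + d)) (\<lambda>z. z) M" "\<And>f. norm (M f) \<le> norm f"
  proof (rule linfrac_multiplier_contraction)
    show "cmod c < cmod d" by (rule linfrac_denominator_less[OF det le])
    show "cmod (a * z + b) \<le> cmod (c * z + d)" if "cmod z = 1" for z
      using linfrac_le_cball(2)[OF det le, of z] that by simp
  qed blast
  show ?thesis
  proof (rule composition_of_contractive_multiplier[OF M])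
    fix z assume "cmod z < 1"
    then show "cmod ((a * z + b) / (c * z + d)) < 1"
      using map by (auto simp: disk_map_def norm_divide divide_less_eq_1)
  qed (rule that)
qed

section \<open>Coposinormality excludes reflected points\<close>

lemma cadjoint_composition_kernel:
  assumes A: "weighted_op (\<lambda>_. 1) \<phi> A" and z: "cmod z < 1" "cmod (\<phi> z) < 1"
  shows "cadjoint A (h2_kernel z) = h2_kernel (\<phi> z)"
proof (rule cinner_eqI)
  fix f
  show "cinner f (cadjoint A (h2_kernel z)) = cinner f (h2_kernel (\<phi> z))"
    using z by (simp add: cinner_kernel weighted_op_apply[OF A]
        flip: cinner_cadjoint[OF weighted_op_bounded[OF A]])
qed

text \<open>\<open>coposinormal_range\<close> gives \<open>f\<close> whose composition with the
  symbol is the kernel at \<open>?\<phi> z\<close>. If the inequality failed, the image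
  \<open>v\<close> of the reflected point \<open>n / m\<close> would lie in the disk, and
  \<open>f\<close> would need a pole there.\<close>

lemma coposinormal_no_reflection:
  fixes a b c d z :: complex
  assumes det: "a * d - b * c \<noteq> 0" and map: "disk_map a b c d"
    and A: "weighted_op (\<lambda>_. 1) (\<lambda>z. (a * z + b) / (c * z + d)) A" and cop: "coposinormal A"
    and z: "cmod z < 1" and nz: "a * z + b \<noteq> 0"
  shows "cmod (c * cnj (c * z + d) + d * cnj (a * z + b)) \<le> cmod (a * cnj (c * z + d) + b * cnj (a * z + b))"
proof (rule ccontr)
  let ?\<phi> = "\<lambda>z. (a * z + b) / (c * z + d)"
  define m n where "m = cnj (a * z + b)" and "n = cnj (c * z + d)"
  define v where "v = (a * n + b * m) / (c * n + d * m)"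
  assume "\<not> ?thesis"
  then have less: "cmod (a * n + b * m) < cmod (c * n + d * m)" by (simp add: m_def n_def)
  then have den: "c * n + d * m \<noteq> 0" and v: "cmod v < 1"
    by (auto simp: v_def norm_divide divide_less_eq_1)
  have denom: "c * w + d \<noteq> 0" and self: "cmod (?\<phi> w) < 1" if "cmod w < 1" for w
    using that map by (auto simp: disk_map_def norm_divide divide_less_eq_1)
  have m: "m \<noteq> 0" and n: "n \<noteq> 0" using nz denom[OF z] by (simp_all only: m_def n_def complex_cnj_zero_iff) auto
  obtain f where f: "A f = h2_kernel (?\<phi> z)"
    using coposinormal_range[OF cop, of "h2_kernel z"] cadjoint_composition_kernel[OF A z self[OF z]] by metis
  \<comment> \<open>With \<open>\<zeta> = ?\<phi> w\<close>, that is
    \<open>w = (d * \<zeta> - b) / (a - c * \<zeta>)\<close>, the equation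
    \<open>h \<zeta> = g \<zeta>\<close> is the kernel identity for \<open>f\<close> with
    denominators cleared.\<close>
  define g where "g \<zeta> = n * (a - c * \<zeta>)" for \<zeta>
  define h where "h \<zeta> = h2_fun f \<zeta> * (n * (a - c * \<zeta>) - m * (d * \<zeta> - b))" for \<zeta>
  have eq: "h (?\<phi> w) = g (?\<phi> w)" if w: "cmod w < 1" for w
  proof -
    have "cnj (?\<phi> z) = m / n" by (simp add: m_def n_def)
    then have fw: "h2_fun f (?\<phi> w) = 1 / (1 - m / n * w)"
      using h2_fun_kernel[OF self[OF z] w] weighted_op_apply[OF A w, of f] by (simp add: f)
    have "cmod (m / n * w) < 1"
      using mult_strict_mono'[of "cmod (m / n)" 1 "cmod w" 1] self[OF z] w \<open>cnj (?\<phi> z) = m / n\<close>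
      by (metis complex_mod_cnj mult_1 norm_ge_zero norm_mult)
    then have "n - m * w \<noteq> 0" using n by (auto simp: field_simps)
    then have fw: "h2_fun f (?\<phi> w) * (n - m * w) = n"
      using n unfolding fw by (simp add: field_simps)
    have "a - c * ?\<phi> w = (a * d - b * c) / (c * w + d)" "d * ?\<phi> w - b = (a * d - b * c) / (c * w + d) * w"
      using denom[OF w] by (simp_all add: field_simps)
    then show ?thesis
      using fw by (simp only: g_def h_def) algebra
  qed
  \<comment> \<open>The functions agree on the open image of the disk, hence on the whole
    disk.\<close>
  have "h v = g v"
  proof (rule analytic_continuation_open[where s = "?\<phi> ` ball 0 1" and s' = "ball 0 1" and f = h and g = g])
    show "open (?\<phi> ` ball 0 1)" by (rule open_linfrac_image[OF det denom])
    show "?\<phi> ` ball 0 1 \<subseteq> ball 0 1" using self by auto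
    show "h holomorphic_on ball 0 1"
      unfolding h_def by (intro holomorphic_intros h2_fun_holomorphic)
    show "g holomorphic_on ball 0 1"
      unfolding g_def by (intro holomorphic_intros)
  qed (use eq v in auto)
  \<comment> \<open>The second factor of \<open>h\<close> vanishes at \<open>v\<close>. This forces
    \<open>g v = 0\<close>, so \<open>a = c * v\<close>, against the nonzero determinant.\<close>
  moreover have v_eq: "v * (c * n + d * m) = a * n + b * m" using den by (simp add: v_def)
  then have "n * (a - c * v) - m * (d * v - b) = 0" by algebra
  then have "h v = 0" by (simp add: h_def)
  ultimately have "a = c * v" using n by (simp add: g_def)
  with v_eq have "m * (a * d - b * c) = 0" by algebra
  then show False using m det by simp
qed

lemma coposinormal_imp_reflection_disjoint:
  fixes a b c d :: complex
  assumes det: "a * d - b * c \<noteq> 0" and map: "disk_map a b c d"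
    and A: "weighted_op (\<lambda>_. 1) (\<lambda>z. (a * z + b) / (c * z + d)) A" and cop: "coposinormal A"
  shows "{einverse (ecnj u) | u. u \<in> lft a b c d ` edisk} \<inter> inv (lft a b c d) ` edisk = {}"
  unfolding reflection_disjoint_iff[OF det]
proof (intro allI impI)
  fix z assume z: "cmod z < 1"
  let ?F = "\<lambda>z. cmod (c * cnj (c * z + d) + d * cnj (a * z + b)) -
    cmod (a * cnj (c * z + d) + b * cnj (a * z + b))"
  have le: "?F w \<le> 0" if "cmod w < 1" "a * w + b \<noteq> 0" for w
    using coposinormal_no_reflection[OF det map A cop that] by simp
  have "?F z \<le> 0"
  proof (cases "a * z + b = 0")
    \<comment> \<open>Here the reflected point is infinity. The numerator has no other zero, so the
      inequality holds nearby and passes to the limit.\<close>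
    case True
    have "\<forall>\<^sub>F w in at z. w \<in> ball 0 1 - {z}"
      using z by (intro eventually_at_in_open) auto
    moreover have "?F w \<le> 0" if w: "w \<in> ball 0 1 - {z}" for w
    proof (rule le)
      show "a * w + b \<noteq> 0"
      proof
        assume "a * w + b = 0"
        with True have "a * (w - z) = 0" by algebra
        then have "a = 0" using w by simp
        then show False using True det by simp
      qed
    qed (use w in auto)
    ultimately have "\<forall>\<^sub>F w in at z. ?F w \<le> 0" by (rule eventually_mono)
    moreover have "(?F \<longlongrightarrow> ?F z) (at z)" by (intro tendsto_intros)
    ultimately show ?thesis by (intro tendsto_upperbound[where F = "at z"]) auto
  qed (use le z in blast)
  then show "cmod (c * cnj (c * z + d) + d * cnj (a * z + b)) \<le> cmod (a * cnj (c * z + d) + b * cnj (a * z + b))"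
    by simp
qed

section \<open>Factorisation of the adjoint\<close>

text \<open>Cowen's formula, with the multiplication operator \<open>H\<close> by \<open>c z + d\<close>.\<close>

lemma cadjoint_linfrac_composition:
  fixes a b c d z :: complex
  assumes det: "a * d - b * c \<noteq> 0" and map: "disk_map a b c d"
    and A: "weighted_op (\<lambda>_. 1) (\<lambda>z. (a * z + b) / (c * z + d)) A"
    and H: "weighted_op (\<lambda>z. c * z + d) (\<lambda>z. z) H"
    and z: "cmod z < 1"
  shows "h2_fun (cadjoint A f) z = 1 / (- cnj b * z + cnj d) *
    h2_fun (cadjoint H f) ((cnj a * z - cnj c) / (- cnj b * z + cnj d))"
proof -
  define \<delta> where "\<delta> = - cnj b * z + cnj d"
  define s where "s = (cnj a * z - cnj c) / \<delta>"
  have less: "cmod (cnj a * z - cnj c) < cmod \<delta>"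
    using disk_map_adjoint[OF det map] z by (simp add: disk_map_def \<delta>_def)
  then have \<delta>: "\<delta> \<noteq> 0" and s: "cmod s < 1" by (auto simp: s_def norm_divide divide_less_eq_1)
  \<comment> \<open>The formula is first checked on kernels; pairing \<open>f\<close> with both
    sides then moves \<open>A\<close> and \<open>H\<close> to their adjoints.\<close>
  have "A (h2_kernel z) = (1 / cnj \<delta>) *\<^sub>C H (h2_kernel s)"
  proof (rule hardy_eq_on_disk)
    fix w assume w: "cmod w < 1"
    have denom: "c * w + d \<noteq> 0" and self: "cmod ((a * w + b) / (c * w + d)) < 1"
      using w map by (auto simp: disk_map_def norm_divide divide_less_eq_1)
    have "cnj \<delta> * cnj s = a * cnj z - c" "cnj \<delta> = d - b * cnj z"
      using \<delta> by (simp_all add: s_def) (simp add: \<delta>_def)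
    then have "cnj \<delta> * (1 - cnj s * w) = (c * w + d) - cnj z * (a * w + b)" by algebra
    then have "1 - cnj z * ((a * w + b) / (c * w + d)) = cnj \<delta> * (1 - cnj s * w) / (c * w + d)"
      using denom by (simp add: diff_divide_distrib)
    then show "h2_fun (A (h2_kernel z)) w = h2_fun ((1 / cnj \<delta>) *\<^sub>C H (h2_kernel s)) w"
      using w z s self by (simp add: weighted_op_apply[OF A] weighted_op_apply[OF H] h2_fun_kernel)
  qed
  then have "cinner f (A (h2_kernel z)) = 1 / \<delta> * cinner f (H (h2_kernel s))"
    by (simp add: cinner_scaleC_right)
  then show ?thesis
    using z s by (simp add: cinner_kernel s_def \<delta>_def
        flip: cinner_cadjoint_left[OF weighted_op_bounded[OF A]]
          cinner_cadjoint_left[OF weighted_op_bounded[OF H]])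
qed

lemma disk_map_imp_coposinormal:
  fixes a b c d :: complex
  assumes det: "a * d - b * c \<noteq> 0" and map: "disk_map a b c d"
    and A: "weighted_op (\<lambda>_. 1) (\<lambda>z. (a * z + b) / (c * z + d)) A"
    and map': "disk_map (cnj a * d + cnj c * c) (- (cnj a * b + cnj c * a))
      (- (cnj b * d + cnj d * c)) (cnj b * b + cnj d * a)" (is "disk_map ?p ?q ?r ?s")
  shows "coposinormal A"
proof -
  have "?p * ?s - ?q * ?r = (a * d - b * c) * (cnj a * cnj d - cnj b * cnj c)" by algebra
  moreover have "cnj a * cnj d - cnj b * cnj c = cnj (a * d - b * c)" by simp
  ultimately have det': "?p * ?s - ?q * ?r \<noteq> 0" using det by (metis complex_cnj_zero_iff mult_eq_0_iff)
  obtain T where T: "weighted_op (\<lambda>_. 1) (\<lambda>z. (?p * z + ?q) / (?r * z + ?s)) T"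
    by (rule linfrac_composition[OF det' map'])
  \<comment> \<open>This symbol is \<open>1 / (- cnj b * w + cnj d)\<close> at the preimage
    \<open>w\<close> of \<open>z\<close> under the given map. It shares its denominator with the
    selfmap of \<open>map'\<close>, which keeps the pole off the closed disk.\<close>
  obtain M where M: "weighted_op (\<lambda>z. (- c * z + a) / (?r * z + ?s)) (\<lambda>z. z) M"
    by (rule linfrac_multiplier[OF linfrac_denominator_less[OF det' disk_map_le[OF map']]])
  obtain H where H: "weighted_op (\<lambda>z. c * z + d) (\<lambda>z. z) H"
    using linfrac_multiplier[of 0 1 c d] by auto
  have "cadjoint A = A \<circ> (M \<circ> T \<circ> cadjoint H)"
  proof (rule ext, rule hardy_eq_on_disk)
    fix f z assume z: "cmod z < 1"
    define D w \<delta> where "D = a * d - b * c" and "w = (a * z + b) / (c * z + d)"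
      and "\<delta> = - cnj b * z + cnj d"
    have denom: "c * z + d \<noteq> 0" and w: "cmod w < 1"
      using z map by (auto simp: disk_map_def norm_divide w_def divide_less_eq_1)
    have D: "D \<noteq> 0" using det by (simp add: D_def)
    have "\<delta> \<noteq> 0"
      using disk_map_adjoint[OF det map] z by (auto simp: disk_map_def \<delta>_def)
    have w_eq: "w * (c * z + d) = a * z + b" using denom by (simp add: w_def)
    \<comment> \<open>Multiplying by \<open>c * z + d\<close> clears the denominator of
      \<open>w\<close> and exposes the common factor \<open>D\<close>, which cancels in both
      quotients below.\<close>
    have eqs: "(- c * w + a) * (c * z + d) = D"
      "(?r * w + ?s) * (c * z + d) = D * \<delta>"
      "(?p * w + ?q) * (c * z + d) = D * (cnj a * z - cnj c)"
      using w_eq unfolding D_def \<delta>_def by algebra+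
    have "(- c * w + a) / (?r * w + ?s) = ((- c * w + a) * (c * z + d)) / ((?r * w + ?s) * (c * z + d))"
      using denom by simp
    then have \<psi>: "(- c * w + a) / (?r * w + ?s) = 1 / \<delta>" using D unfolding eqs by simp
    have "(?p * w + ?q) / (?r * w + ?s) = ((?p * w + ?q) * (c * z + d)) / ((?r * w + ?s) * (c * z + d))"
      using denom by simp
    then have \<tau>: "(?p * w + ?q) / (?r * w + ?s) = (cnj a * z - cnj c) / \<delta>" using D unfolding eqs by simp
    have "h2_fun ((A \<circ> (M \<circ> T \<circ> cadjoint H)) f) z = h2_fun (M (T (cadjoint H f))) w"
      using weighted_op_apply[OF A z] by (simp add: w_def)
    also have "\<dots> = 1 / \<delta> * h2_fun (cadjoint H f) ((cnj a * z - cnj c) / \<delta>)"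
      unfolding weighted_op_apply[OF M w] weighted_op_apply[OF T w] \<psi> \<tau> by simp
    also have "\<dots> = h2_fun (cadjoint A f) z"
      unfolding cadjoint_linfrac_composition[OF det map A H z] \<delta>_def ..
    finally show "h2_fun (cadjoint A f) z = h2_fun ((A \<circ> (M \<circ> T \<circ> cadjoint H)) f) z" ..
  qed
  moreover have "bounded_clinear (M \<circ> T \<circ> cadjoint H)"
    by (intro bounded_clinear_comp bounded_clinear_cadjoint weighted_op_bounded[OF M]
        weighted_op_bounded[OF T] weighted_op_bounded[OF H])
  ultimately show ?thesis by (intro coposinormalI[OF weighted_op_bounded[OF A]])
qed

theorem theorem2p2:
  fixes a b c d :: complex and \<phi> \<sigma> :: "ecomplex \<Rightarrow> ecomplex"
  assumes nonconstant: "a * d - b * c \<noteq> 0"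
    and phi: "\<phi> = lft a b c d"
    and sigma: "\<sigma> = lft (cnj a) (- cnj c) (- cnj b) (cnj d)"
    and selfmap: "\<phi> ` edisk \<subseteq> edisk"
  shows "(coposinormal (composition_op (\<lambda>z. (a * z + b) / (c * z + d)))
            \<longleftrightarrow> {einverse (ecnj u) | u. u \<in> \<phi> ` edisk} \<inter> inv \<phi> ` edisk = {})
       \<and> ({einverse (ecnj u) | u. u \<in> \<phi> ` edisk} \<inter> inv \<phi> ` edisk = {}
            \<longleftrightarrow> (\<sigma> \<circ> inv \<phi>) ` edisk \<subseteq> edisk)"
proof -
  let ?p = "cnj a * d + cnj c * c" and ?q = "- (cnj a * b + cnj c * a)"
  let ?r = "- (cnj b * d + cnj d * c)" and ?s = "cnj b * b + cnj d * a"
  have map: "disk_map a b c d"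
    using selfmap unfolding phi lft_image_edisk_subset[OF nonconstant] .
  obtain A where A: "weighted_op (\<lambda>_. 1) (\<lambda>z. (a * z + b) / (c * z + d)) A"
    by (rule linfrac_composition[OF nonconstant map])
  have cnj_det: "cnj a * cnj d - cnj b * cnj c \<noteq> 0"
    using nonconstant by (metis complex_cnj_diff complex_cnj_mult complex_cnj_zero_iff)
  then have "cnj a * cnj d - (- cnj c) * (- cnj b) \<noteq> 0" by (simp add: mult.commute)
  moreover have "cnj a * d - (- cnj c) * c = ?p" "- cnj c * a - cnj a * b = ?q"
    "- cnj b * d - cnj d * c = ?r" "cnj d * a - (- cnj b) * b = ?s" by simp_all
  \<comment> \<open>The coefficients are those of the matrix of \<open>\<sigma>\<close> times the
    adjugate of the matrix of \<open>\<phi>\<close>.\<close>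
  ultimately have comp: "\<sigma> \<circ> inv \<phi> = lft ?p ?q ?r ?s"
    unfolding phi sigma using lft_comp_inv[OF nonconstant] by metis
  have "?p * ?s - ?q * ?r = (a * d - b * c) * (cnj a * cnj d - cnj b * cnj c)" by algebra
  then have "?p * ?s - ?q * ?r \<noteq> 0" using nonconstant cnj_det by simp
  then have c: "(\<sigma> \<circ> inv \<phi>) ` edisk \<subseteq> edisk \<longleftrightarrow> disk_map ?p ?q ?r ?s"
    unfolding comp by (rule lft_image_edisk_subset)
  \<comment> \<open>Disjointness and the selfmap property are now the same \<open>disk_map\<close>
    condition; what remains is its equivalence with coposinormality.\<close>
  note b = reflection_disjoint_iff_disk_map[OF nonconstant, folded phi]
  show ?thesis
    unfolding composition_op_eq[OF A] c b
    using coposinormal_imp_reflection_disjoint[OF nonconstant map A, folded phi, unfolded b]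
      disk_map_imp_coposinormal[OF nonconstant map A] by blast
qed

end
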